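(* Let $f:[0,\infty)\to\mathbb R$ be continuous and nonconstant, with a finite limit at infinity. For a probability law $\sigma$ on $\mathbb R^2$, put $$\mathcal F_f(\sigma)=\frac12\,\mathbb E\operatorname{tr}f\left(\frac{y_1y_1^{\mathsf T}+y_2y_2^{\mathsf T}}{2}\right),\qquad y_1,y_2\ \text{i.i.d.}\sim\sigma.$$ There exist compactly supported laws $\sigma_+,\sigma_-$ on $\mathbb R^2$ with the same two-point distribution of $r=\|y\|^2/2$, satisfying (for $y\sim\sigma_+$ and for $y\sim\sigma_-$) $\mathbb E[y\mid r]=0$ and $\mathbb E[yy^{\mathsf T}\mid r]=rI_2$, such that $\sigma_0=(\sigma_++\sigma_-)/2$ is spherical (invariant under all orthogonal transformations of $\mathbb R^2$) and $$\mathcal F_f(\sigma_+)=\mathcal F_f(\sigma_-)>\mathcal F_f(\sigma_0).$$ The angular symmetrization of $\sigma_+$ and that of $\sigma_-$ are both equal to $\sigma_0$. Thus concavity of $\mathcal F_f$ in the column law $\sigma$ and universal maximization of $\mathcal F_f$ by angular symmetrization both fail, even with a fixed radial marginal and exact conditional isotropy.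
   Context: For a real symmetric positive semidefinite matrix $H$, $f(H)$ is defined by the spectral functional calculus, and $\operatorname{tr}$ is the unnormalized trace. The angular symmetrization of a law $\sigma$ on $\mathbb R^2$ is the law of $Oy$ with $y\sim\sigma$ and $O$ an independent Haar-distributed $2\times2$ orthogonal matrix. *)

theory Defs
  imports "HOL-Probability.Probability"
begin

text \<open>The spectral functional calculus on real symmetric matrices.  Any two orthogonal
  diagonalizations of \<open>H\<close> give the same \<open>f(H)\<close>, so for symmetric \<open>H\<close> the description is
  proper; only the values of \<open>f\<close> on the spectrum of \<open>H\<close> matter.\<close>

definition diag_mat :: "real ^ 'n \<Rightarrow> real ^ 'n ^ 'n" where
  "diag_mat d = (\<chi> i j. if i = j then d $ i else 0)"

definition matrix_fun :: "(real \<Rightarrow> real) \<Rightarrow> real ^ 'n ^ 'n \<Rightarrow> real ^ 'n ^ 'n" where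
  "matrix_fun f H = (THE A. \<exists>P d. orthogonal_matrix P \<and>
      H = P ** diag_mat d ** transpose P \<and>
      A = P ** diag_mat (\<chi> i. f (d $ i)) ** transpose P)"

definition outer :: "real ^ 'n \<Rightarrow> real ^ 'n ^ 'n" where
  "outer y = (\<chi> i j. y $ i * y $ j)"

definition laws :: "'a::topological_space measure set" where
  "laws = {\<sigma>. prob_space \<sigma> \<and> sets \<sigma> = sets borel}"

definition mix_law :: "real \<Rightarrow> 'a measure \<Rightarrow> 'a measure \<Rightarrow> 'a measure" where
  "mix_law t \<mu> \<nu> = measure_of (space \<mu>) (sets \<mu>)
     (\<lambda>A. ennreal t * emeasure \<mu> A + ennreal (1 - t) * emeasure \<nu> A)"

definition compactly_supported :: "'a::topological_space measure \<Rightarrow> bool" where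
  "compactly_supported \<sigma> \<longleftrightarrow> (\<exists>K. compact K \<and> (AE y in \<sigma>. y \<in> K))"

definition two_point_law :: "real measure \<Rightarrow> bool" where
  "two_point_law \<rho> \<longleftrightarrow> (\<exists>a b p. a \<noteq> b \<and> 0 < p \<and> p < 1 \<and>
     \<rho> = mix_law p (return borel a) (return borel b))"

definition F_fun :: "(real \<Rightarrow> real) \<Rightarrow> (real ^ 2) measure \<Rightarrow> real" where
  "F_fun f \<sigma> = 1 / 2 *
     (\<integral>(y1, y2). trace (matrix_fun f ((1 / 2) *\<^sub>R (outer y1 + outer y2))) \<partial>(\<sigma> \<Otimes>\<^sub>M \<sigma>))"

definition radius :: "real ^ 2 \<Rightarrow> real" where
  "radius y = (norm y)\<^sup>2 / 2"

definition radial_law :: "(real ^ 2) measure \<Rightarrow> real measure" where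
  "radial_law \<sigma> = distr \<sigma> borel radius"

text \<open>Conditioning on \<open>r\<close> is conditioning on the sigma-algebra generated by \<open>radius\<close>.  The
  vector and matrix conditional expectations are taken entrywise, and the second-moment
  condition makes all of them meaningful.\<close>

definition cond_exp_radius :: "(real ^ 2) measure \<Rightarrow> (real ^ 2 \<Rightarrow> real) \<Rightarrow> real ^ 2 \<Rightarrow> real" where
  "cond_exp_radius \<sigma> g = real_cond_exp \<sigma> (vimage_algebra (space \<sigma>) radius borel) g"

definition cond_isotropic :: "(real ^ 2) measure \<Rightarrow> bool" where
  "cond_isotropic \<sigma> \<longleftrightarrow>
     integrable \<sigma> (\<lambda>y. (norm y)\<^sup>2) \<and>
     (\<forall>i. AE y in \<sigma>. cond_exp_radius \<sigma> (\<lambda>z. z $ i) y = 0) \<and>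
     (\<forall>i j. AE y in \<sigma>. cond_exp_radius \<sigma> (\<lambda>z. outer z $ i $ j) y
        = (radius y *\<^sub>R (mat 1 :: real ^ 2 ^ 2)) $ i $ j)"

definition spherical :: "(real ^ 'n) measure \<Rightarrow> bool" where
  "spherical \<sigma> \<longleftrightarrow> (\<forall>U. orthogonal_matrix U \<longrightarrow> distr \<sigma> borel ((*v) U) = \<sigma>)"

text \<open>The Haar probability measure on the orthogonal group, as a Borel measure on the space of
  matrices concentrated on the orthogonal ones.\<close>

definition is_haar_orthogonal :: "(real ^ 'n ^ 'n) measure \<Rightarrow> bool" where
  "is_haar_orthogonal \<mu> \<longleftrightarrow> \<mu> \<in> laws \<and> (AE U in \<mu>. orthogonal_matrix U) \<and>
     (\<forall>U. orthogonal_matrix U \<longrightarrow> distr \<mu> borel ((**) U) = \<mu>)"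

definition haar_orthogonal :: "(real ^ 'n ^ 'n) measure" where
  "haar_orthogonal = (THE \<mu>. is_haar_orthogonal \<mu>)"

definition angular_symmetrization :: "(real ^ 2) measure \<Rightarrow> (real ^ 2) measure" where
  "angular_symmetrization \<sigma> =
     distr ((haar_orthogonal :: (real ^ 2 ^ 2) measure) \<Otimes>\<^sub>M \<sigma>) borel (\<lambda>(U, y). U *v y)"

definition isotropic_laws :: "real measure \<Rightarrow> (real ^ 2) measure set" where
  "isotropic_laws \<rho> = {\<sigma> \<in> laws. radial_law \<sigma> = \<rho> \<and> cond_isotropic \<sigma>}"

definition concave_on_laws :: "'a measure set \<Rightarrow> ('a measure \<Rightarrow> real) \<Rightarrow> bool" where
  "concave_on_laws S F \<longleftrightarrow> (\<forall>\<sigma>\<in>S. \<forall>\<tau>\<in>S. \<forall>t. 0 \<le> t \<and> t \<le> 1 \<longrightarrow>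
     t * F \<sigma> + (1 - t) * F \<tau> \<le> F (mix_law t \<sigma> \<tau>))"

end

(* Write y = sqrt (2 r) (cos phi, sin phi). For radii r, s and an angle difference phi, the matrix
   (y1 y1^T + y2 y2^T) / 2 has eigenvalues (r + s) / 2 +- sqrt (r^2 + s^2 + 2 r s cos (2 phi)) / 2.
   Put on the two circles r = s and r = R the angular densities 1 +- c cos (2 k phi) and
   1 +- d cos (2 k phi). For k >= 2 they leave the conditional first and second moments unchanged, and
   by orthogonality F(sigma_+) - F(sigma_0) is a positive multiple of the quadratic form in (c, d) whose
   coefficients are the k-th Fourier coefficients of the kernel f(lambda_+) + f(lambda_-). As R tends to
   infinity, lambda_- tends to s (1 - cos (2 phi)) / 2 and lambda_+ to infinity, so the mixed coefficient
   tends to the k-th coefficient of f (s (1 - cos (2 phi)) / 2) while the (R, R) coefficient tends to 0.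
   If that limit is nonzero, the form is positive somewhere for large R. If it vanished for all s and
   all k >= 2, then f would be affine on every [0, s], hence constant because it has a finite limit. *)

theory Submission
  imports Defs "HOL-Library.Periodic_Fun" "HOL-Real_Asymp.Real_Asymp"
begin

section \<open>The uniform angle\<close>

text \<open>One circle would not suffice: there the change of the functional is
  \<open>c\<^sup>2\<close> times a single coefficient whose sign depends on f. With two circles and
  a vanishing (R, R) entry, a nonzero mixed entry makes the limiting form indefinite, whatever the
  sign of the (s, s) entry. The (R, R) entry vanishes in the limit because for almost every angle
  both eigenvalues escape, so that the kernel tends to the constant 2 L. No term linear in (c, d)
  survives, since averaging the kernel over a uniform second angle leaves a constant; the form is
  therefore even, and opposite amplitudes give equal values. Affine f are the obstruction: there the
  trace depends on the two radii alone, so no modulation of the angles changes the functional. As f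
  is prescribed only on the half-line, the analysis runs with f (max 0 x), which is continuous and
  bounded on the line and gives the same functional because the matrices are positive semidefinite.
  The Haar measure is introduced by a definite description, so an explicit Haar measure and its
  uniqueness must both be established before angular symmetrization can be computed.\<close>

lemma emeasure_lborel_isometry:
  fixes t c :: real
  assumes A: "A \<in> sets borel" and c: "\<bar>c\<bar> = 1"
  shows "emeasure lborel {x. t + c * x \<in> A} = emeasure lborel A"
proof -
  have [measurable]: "A \<in> sets borel" by fact
  have S: "{x. t + c * x \<in> A} \<in> sets borel" by measurable
  have "emeasure lborel A = (\<integral>\<^sup>+x. indicator A x \<partial>lborel)" by simp
  also have "\<dots> = \<bar>c\<bar> * (\<integral>\<^sup>+x. indicator A (t + c * x) \<partial>lborel)"
    by (rule nn_integral_real_affine) (use c in auto)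
  also have "\<dots> = (\<integral>\<^sup>+x. indicator {x. t + c * x \<in> A} x \<partial>lborel)"
    using c by (simp add: indicator_def)
  also have "\<dots> = emeasure lborel {x. t + c * x \<in> A}"
    using S by simp
  finally show ?thesis by simp
qed

definition unif :: "real measure" where
  "unif = uniform_measure lborel {0..<2*pi}"

lemma prob_space_unif: "prob_space unif"
  unfolding unif_def by (rule prob_space_uniform_measure) auto

lemma sets_unif [simp, measurable_cong]: "sets unif = sets borel"
  by (simp add: unif_def)

lemma space_unif [simp]: "space unif = UNIV"
  by (simp add: unif_def)

lemma emeasure_unif:
  "B \<in> sets borel \<Longrightarrow> emeasure unif B = emeasure lborel ({0..<2*pi} \<inter> B) / ennreal (2*pi)"
  by (simp add: unif_def)

text \<open>Cut the window at \<open>2*pi - \<alpha>\<close>. The part \<open>?L\<close> stays in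
  the window after the shift, the part \<open>?R\<close> wraps around; moved by \<alpha> and by
  \<open>\<alpha> - 2*pi\<close>, they tile the window again.\<close>

lemma emeasure_period_shift:
  fixes B :: "real set"
  assumes B [measurable]: "B \<in> sets borel" and per: "\<And>x. x + 2*pi \<in> B \<longleftrightarrow> x \<in> B"
    and \<alpha>: "0 \<le> \<alpha>" "\<alpha> < 2*pi"
  shows "emeasure lborel ({0..<2*pi} \<inter> {x. x + \<alpha> \<in> B}) = emeasure lborel ({0..<2*pi} \<inter> B)"
proof -
  let ?L = "{x. \<alpha> + 1 * x \<in> {\<alpha>..<2*pi} \<inter> B}"
  let ?R = "{x. (\<alpha> - 2*pi) + 1 * x \<in> {0..<\<alpha>} \<inter> B}"
  have mod: "x - 2*pi \<in> B \<longleftrightarrow> x \<in> B" for x using per[of "x - 2*pi"] by simp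
  have mod': "\<alpha> - 2*pi + x \<in> B \<longleftrightarrow> x + \<alpha> \<in> B" for x
    using mod[of "x + \<alpha>"] by (simp add: algebra_simps)
  have split: "{0..<2*pi} \<inter> {x. x + \<alpha> \<in> B} = ?L \<union> ?R"
    using \<alpha> mod' by (auto simp: algebra_simps)
  have "emeasure lborel (?L \<union> ?R) = emeasure lborel ?L + emeasure lborel ?R"
    using \<alpha> by (intro plus_emeasure[symmetric]) (measurable, auto)
  also have "\<dots> = emeasure lborel ({\<alpha>..<2*pi} \<inter> B) + emeasure lborel ({0..<\<alpha>} \<inter> B)"
    by (subst (1 2) emeasure_lborel_isometry) auto
  also have "\<dots> = emeasure lborel (({\<alpha>..<2*pi} \<inter> B) \<union> ({0..<\<alpha>} \<inter> B))"
    by (intro plus_emeasure) auto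
  also have "({\<alpha>..<2*pi} \<inter> B) \<union> ({0..<\<alpha>} \<inter> B) = {0..<2*pi} \<inter> B"
    using \<alpha> by auto
  finally show ?thesis using split by simp
qed

text \<open>The map x to \<open>2*pi - x\<close> preserves the open window, and by periodicity it
  agrees with negation as far as membership in \<open>B\<close> goes. The endpoint 0 is removed
  first, as a null set.\<close>

lemma emeasure_period_reflect:
  fixes B :: "real set"
  assumes B [measurable]: "B \<in> sets borel" and per: "\<And>x. x + 2*pi \<in> B \<longleftrightarrow> x \<in> B"
  shows "emeasure lborel ({0..<2*pi} \<inter> {x. - x \<in> B}) = emeasure lborel ({0..<2*pi} \<inter> B)"
proof -
  have mod: "2*pi - x \<in> B \<longleftrightarrow> - x \<in> B" for x using per[of "-x"] by simp
  have null: "emeasure lborel ({0..<2*pi} \<inter> C) = emeasure lborel ({0<..<2*pi} \<inter> C)"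
    if [measurable]: "C \<in> sets borel" for C
  proof (rule emeasure_eq_AE)
    have "AE x in lborel. x \<noteq> (0::real)" by (rule AE_lborel_singleton)
    then show "AE x in lborel. (x \<in> {0..<2*pi} \<inter> C) = (x \<in> {0<..<2*pi} \<inter> C)"
      by eventually_elim auto
  qed auto
  have "{0<..<2*pi} \<inter> {x. - x \<in> B} = {x. 2*pi + (-1) * x \<in> {0<..<2*pi} \<inter> B}"
    using mod by auto
  then have "emeasure lborel ({0<..<2*pi} \<inter> {x. - x \<in> B}) = emeasure lborel ({0<..<2*pi} \<inter> B)"
    using emeasure_lborel_isometry[of "{0<..<2*pi} \<inter> B" "-1" "2*pi"] by simp
  then show ?thesis
    by (subst (1 2) null) (auto simp: pred_def)
qed

text \<open>A shifted angle leaves the window, so invariance holds only after a periodic map has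
  been applied. The target space is arbitrary in order to cover both integrals and laws of random
  matrices. Reducing \<alpha> modulo \<open>2*pi\<close> leads back to
  \<open>emeasure_period_shift\<close>.\<close>

lemma distr_unif_shift:
  fixes g :: "real \<Rightarrow> 'a"
  assumes g [measurable]: "g \<in> borel \<rightarrow>\<^sub>M M" and per: "\<And>x. g (x + 2*pi) = g x"
  shows "distr unif M (\<lambda>x. g (x + \<alpha>)) = distr unif M g"
proof -
  interpret periodic_fun_simple g "2*pi" by standard (rule per)
  define n where "n = \<lfloor>\<alpha> / (2*pi)\<rfloor>"
  define \<beta> where "\<beta> = \<alpha> - of_int n * (2*pi)"
  have \<beta>: "0 \<le> \<beta>" "\<beta> < 2*pi"
  proof -
    have "of_int n \<le> \<alpha> / (2*pi)" "\<alpha> / (2*pi) < of_int n + 1" unfolding n_def by linarith+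
    then show "0 \<le> \<beta>" "\<beta> < 2*pi" unfolding \<beta>_def by (auto simp: field_simps)
  qed
  have g\<beta>: "g (x + \<alpha>) = g (x + \<beta>)" for x
    using plus_of_int[of "x + \<beta>" n] by (simp add: \<beta>_def algebra_simps)
  show ?thesis
  proof (rule measure_eqI)
    fix A assume "A \<in> sets (distr unif M (\<lambda>x. g (x + \<alpha>)))"
    then have [measurable]: "A \<in> sets M" by simp
    have B: "{x. g x \<in> A} \<in> sets borel" using measurable_sets[OF g, of A] by (simp add: vimage_def)
    have B': "{x. g (x + \<beta>) \<in> A} \<in> sets borel"
    proof -
      have "(\<lambda>x. g (x + \<beta>)) \<in> borel \<rightarrow>\<^sub>M M" by measurable
      from measurable_sets[OF this, of A] show ?thesis by (simp add: vimage_def)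
    qed
    have "emeasure (distr unif M (\<lambda>x. g (x + \<alpha>))) A = emeasure unif {x. g (x + \<beta>) \<in> A}"
      by (subst emeasure_distr) (auto simp: g\<beta> vimage_def)
    also have "\<dots> = emeasure unif {x. g x \<in> A}"
      using emeasure_period_shift[OF B _ \<beta>] B B' per by (simp add: emeasure_unif)
    also have "\<dots> = emeasure (distr unif M g) A"
      by (subst emeasure_distr) (auto simp: vimage_def)
    finally show "emeasure (distr unif M (\<lambda>x. g (x + \<alpha>))) A = emeasure (distr unif M g) A" .
  qed simp
qed

text \<open>Negation composed with a shift by \<open>- \<alpha>\<close>.\<close>

lemma distr_unif_reflect:
  fixes g :: "real \<Rightarrow> 'a"
  assumes g [measurable]: "g \<in> borel \<rightarrow>\<^sub>M M" and per: "\<And>x. g (x + 2*pi) = g x"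
  shows "distr unif M (\<lambda>x. g (\<alpha> - x)) = distr unif M g"
proof -
  have refl: "distr unif M (\<lambda>x. g (- x)) = distr unif M g"
  proof (rule measure_eqI)
    fix A assume "A \<in> sets (distr unif M (\<lambda>x. g (- x)))"
    then have [measurable]: "A \<in> sets M" by simp
    have B: "{x. g x \<in> A} \<in> sets borel" using measurable_sets[OF g, of A] by (simp add: vimage_def)
    have B': "{x. g (- x) \<in> A} \<in> sets borel"
    proof -
      have "(\<lambda>x. g (- x)) \<in> borel \<rightarrow>\<^sub>M M" by measurable
      from measurable_sets[OF this, of A] show ?thesis by (simp add: vimage_def)
    qed
    have "emeasure (distr unif M (\<lambda>x. g (- x))) A = emeasure unif {x. g (- x) \<in> A}"
      by (subst emeasure_distr) (auto simp: vimage_def)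
    also have "\<dots> = emeasure unif {x. g x \<in> A}"
      using emeasure_period_reflect[OF B] B B' per by (simp add: emeasure_unif)
    also have "\<dots> = emeasure (distr unif M g) A"
      by (subst emeasure_distr) (auto simp: vimage_def)
    finally show "emeasure (distr unif M (\<lambda>x. g (- x))) A = emeasure (distr unif M g) A" .
  qed simp
  have per': "g (- (x + 2*pi)) = g (- x)" for x using per[of "- x - 2*pi"] by simp
  have "distr unif M (\<lambda>x. g (- (x + (- \<alpha>)))) = distr unif M (\<lambda>x. g (- x))"
    by (rule distr_unif_shift) (use per' in auto)
  then show ?thesis using refl by simp
qed

lemma integral_unif_shift:
  fixes g :: "real \<Rightarrow> real"
  assumes g [measurable]: "g \<in> borel_measurable borel" and per: "\<And>x. g (x + 2*pi) = g x"
  shows "(\<integral>x. g (x + \<alpha>) \<partial>unif) = (\<integral>x. g x \<partial>unif)"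
proof -
  have "(\<integral>x. g (x + \<alpha>) \<partial>unif) = (\<integral>x. x \<partial>distr unif borel (\<lambda>x. g (x + \<alpha>)))"
    by (subst integral_distr) auto
  also have "\<dots> = (\<integral>x. x \<partial>distr unif borel g)"
    by (subst distr_unif_shift[OF g per]) simp
  also have "\<dots> = (\<integral>x. g x \<partial>unif)"
    by (subst integral_distr) auto
  finally show ?thesis .
qed

lemma integral_unif_reflect:
  fixes g :: "real \<Rightarrow> real"
  assumes g [measurable]: "g \<in> borel_measurable borel" and per: "\<And>x. g (x + 2*pi) = g x"
  shows "(\<integral>x. g (\<alpha> - x) \<partial>unif) = (\<integral>x. g x \<partial>unif)"
proof -
  have "(\<integral>x. g (\<alpha> - x) \<partial>unif) = (\<integral>x. x \<partial>distr unif borel (\<lambda>x. g (\<alpha> - x)))"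
    by (subst integral_distr) auto
  also have "\<dots> = (\<integral>x. x \<partial>distr unif borel g)"
    by (subst distr_unif_reflect[OF g per]) simp
  also have "\<dots> = (\<integral>x. g x \<partial>unif)"
    by (subst integral_distr) auto
  finally show ?thesis .
qed

lemma integrable_unif:
  fixes g :: "real \<Rightarrow> real"
  assumes "g \<in> borel_measurable borel" and "\<And>x. \<bar>g x\<bar> \<le> B"
  shows "integrable unif g"
proof -
  interpret prob_space unif by (rule prob_space_unif)
  show ?thesis by (rule integrable_const_bound[where B = B]) (use assms in auto)
qed

lemma integrable_unif_trig [simp]:
  "integrable unif (\<lambda>x. cos (a * x))" "integrable unif (\<lambda>x. sin (a * x))"
  by (rule integrable_unif[where B = 1]; simp)+

lemma integral_unif_const [simp]: "(\<integral>x. (c::real) \<partial>unif) = c"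
proof -
  interpret prob_space unif by (rule prob_space_unif)
  show ?thesis using prob_space by simp
qed

lemma cos_period_int: "cos (of_int m * (x + 2*pi)) = cos (of_int m * x)"
  and sin_period_int: "sin (of_int m * (x + 2*pi)) = sin (of_int m * x)"
  using sin_cos_eq_iff[of "of_int m * (x + 2*pi)" "of_int m * x"]
  by (auto simp: algebra_simps)

text \<open>A shift by half a period of the integrand changes its sign.\<close>

lemma integral_unif_cos:
  assumes "m \<noteq> 0" shows "(\<integral>x. cos (of_int m * x) \<partial>unif) = 0"
proof -
  have "cos (of_int m * (x + pi / of_int m)) = - cos (of_int m * x)" for x :: real
    using assms by (simp add: algebra_simps)
  then show ?thesis
    using integral_unif_shift[of "\<lambda>x. cos (of_int m * x)" "pi / of_int m"]
    by (simp add: cos_period_int)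
qed

lemma integral_unif_sin: "(\<integral>x. sin (of_int m * x) \<partial>unif) = 0"
proof -
  have "sin (of_int m * (0 - x)) = - sin (of_int m * x)" for x :: real by simp
  then show ?thesis
    using integral_unif_reflect[of "\<lambda>x. sin (of_int m * x)" 0]
    by (simp add: sin_period_int)
qed

text \<open>The product formula leaves the frequencies m - n and m + n, and only frequency 0 has a
  nonzero mean. Both indicator terms count when m = n = 0.\<close>

lemma integral_unif_cos_cos:
  "(\<integral>x. cos (of_int m * x) * cos (of_int n * x) \<partial>unif) =
     ((if m = n then 1 else 0) + (if m = - n then 1 else 0)) / 2"
proof -
  have "cos (of_int m * x) * cos (of_int n * x) =
      cos (of_int (m - n) * x) / 2 + cos (of_int (m + n) * x) / 2" for x :: real
    by (simp add: cos_times_cos algebra_simps add_divide_distrib)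
  moreover have "(\<integral>x. cos (of_int k * x) \<partial>unif) = (if k = 0 then 1 else 0)" for k
    by (cases "k = 0") (simp_all add: integral_unif_cos del: lebesgue_integral_const)
  ultimately show ?thesis by (auto simp del: of_int_add of_int_diff)
qed

lemma integral_unif_sin_cos:
  "(\<integral>x. sin (of_int m * x) * cos (of_int n * x) \<partial>unif) = 0"
proof -
  have "sin (of_int m * x) * cos (of_int n * x) =
      sin (of_int (m + n) * x) / 2 + sin (of_int (m - n) * x) / 2" for x :: real
    unfolding sin_times_cos by (simp add: algebra_simps add_divide_distrib)
  then show ?thesis by (simp add: integral_unif_sin del: of_int_add of_int_diff)
qed

section \<open>Mixtures of laws\<close>

lemma space_mix_law [simp]: "space (mix_law t \<mu> \<nu>) = space \<mu>"
  by (simp add: mix_law_def space_measure_of_conv)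

lemma sets_mix_law [simp, measurable_cong]: "sets (mix_law t \<mu> \<nu>) = sets \<mu>"
  by (simp add: mix_law_def sets.sigma_sets_eq sets_measure_of_conv sets.space_closed)

text \<open>\<open>measure_of\<close> returns the prescribed set function only if that function is
  countably additive, which is what has to be checked here.\<close>

lemma emeasure_mix_law:
  assumes S: "sets \<nu> = sets \<mu>" and A: "A \<in> sets \<mu>"
  shows "emeasure (mix_law t \<mu> \<nu>) A = ennreal t * emeasure \<mu> A + ennreal (1 - t) * emeasure \<nu> A"
  unfolding mix_law_def
proof (rule emeasure_measure_of_sigma[OF sets.sigma_algebra_axioms _ _ A])
  show "positive (sets \<mu>) (\<lambda>A. ennreal t * emeasure \<mu> A + ennreal (1 - t) * emeasure \<nu> A)"
    by (simp add: positive_def)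
  show "countably_additive (sets \<mu>) (\<lambda>A. ennreal t * emeasure \<mu> A + ennreal (1 - t) * emeasure \<nu> A)"
    unfolding countably_additive_def
  proof (intro allI impI)
    fix F :: "nat \<Rightarrow> 'a set" assume F: "range F \<subseteq> sets \<mu>" "disjoint_family F"
    have "(\<Sum>i. ennreal t * emeasure \<mu> (F i) + ennreal (1 - t) * emeasure \<nu> (F i)) =
      (\<Sum>i. ennreal t * emeasure \<mu> (F i)) + (\<Sum>i. ennreal (1 - t) * emeasure \<nu> (F i))"
      by (rule suminf_add[symmetric]) auto
    also have "\<dots> = ennreal t * emeasure \<mu> (\<Union>i. F i) + ennreal (1 - t) * emeasure \<nu> (\<Union>i. F i)"
      using F S by (simp add: suminf_emeasure)
    finally show "(\<Sum>i. ennreal t * emeasure \<mu> (F i) + ennreal (1 - t) * emeasure \<nu> (F i)) =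
      ennreal t * emeasure \<mu> (\<Union>i. F i) + ennreal (1 - t) * emeasure \<nu> (\<Union>i. F i)" .
  qed
qed

lemma nn_integral_mix_law:
  assumes S: "sets \<nu> = sets \<mu>" and g: "g \<in> borel_measurable \<mu>"
  shows "(\<integral>\<^sup>+x. g x \<partial>mix_law t \<mu> \<nu>) = ennreal t * (\<integral>\<^sup>+x. g x \<partial>\<mu>) + ennreal (1 - t) * (\<integral>\<^sup>+x. g x \<partial>\<nu>)"
proof -
  have sp: "space \<nu> = space \<mu>" using S by (rule sets_eq_imp_space_eq)
  have m\<nu>: "borel_measurable \<nu> = borel_measurable \<mu>" and mm: "borel_measurable (mix_law t \<mu> \<nu>) = borel_measurable \<mu>"
    using S by (auto intro: measurable_cong_sets)
  from g show ?thesis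
  proof induct
    case (cong f g)
    moreover have "(\<integral>\<^sup>+x. f x \<partial>M) = (\<integral>\<^sup>+x. g x \<partial>M)" if "space M = space \<mu>" for M
      using cong that by (intro nn_integral_cong) auto
    ultimately show ?case using sp by simp
  next
    case (set A)
    then show ?case using S by (simp add: emeasure_mix_law)
  next
    case (mult u c)
    then show ?case by (simp add: nn_integral_cmult m\<nu> mm distrib_left mult.left_commute)
  next
    case (add u v)
    then show ?case by (simp add: nn_integral_add m\<nu> mm distrib_left algebra_simps)
  next
    case (seq U)
    have "(\<integral>\<^sup>+x. (SUP i. U i x) \<partial>mix_law t \<mu> \<nu>) = (SUP i. \<integral>\<^sup>+x. U i x \<partial>mix_law t \<mu> \<nu>)"
      using seq mm by (intro nn_integral_monotone_convergence_SUP) auto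
    also have "\<dots> = (SUP i. ennreal t * (\<integral>\<^sup>+x. U i x \<partial>\<mu>) + ennreal (1 - t) * (\<integral>\<^sup>+x. U i x \<partial>\<nu>))"
      using seq by simp
    also have "\<dots> = (SUP i. ennreal t * (\<integral>\<^sup>+x. U i x \<partial>\<mu>)) + (SUP i. ennreal (1 - t) * (\<integral>\<^sup>+x. U i x \<partial>\<nu>))"
      using seq by (intro ennreal_SUP_add incseq_SucI mult_left_mono nn_integral_mono)
        (auto simp: incseq_Suc_iff le_fun_def)
    also have "\<dots> = ennreal t * (SUP i. \<integral>\<^sup>+x. U i x \<partial>\<mu>) + ennreal (1 - t) * (SUP i. \<integral>\<^sup>+x. U i x \<partial>\<nu>)"
      by (simp add: SUP_mult_left_ennreal)
    also have "(SUP i. \<integral>\<^sup>+x. U i x \<partial>\<mu>) = (\<integral>\<^sup>+x. (SUP i. U i x) \<partial>\<mu>)"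
      using seq by (intro nn_integral_monotone_convergence_SUP[symmetric]) auto
    also have "(SUP i. \<integral>\<^sup>+x. U i x \<partial>\<nu>) = (\<integral>\<^sup>+x. (SUP i. U i x) \<partial>\<nu>)"
      using seq m\<nu> by (intro nn_integral_monotone_convergence_SUP[symmetric]) auto
    finally show ?case by (simp add: SUP_apply image_comp)
  qed
qed

lemma prob_space_mix_law:
  assumes "prob_space \<mu>" "prob_space \<nu>" "sets \<nu> = sets \<mu>" "0 \<le> t" "t \<le> 1"
  shows "prob_space (mix_law t \<mu> \<nu>)"
proof
  have "space \<nu> = space \<mu>" using assms(3) by (rule sets_eq_imp_space_eq)
  then show "emeasure (mix_law t \<mu> \<nu>) (space (mix_law t \<mu> \<nu>)) = 1"
    using assms prob_space.emeasure_space_1[OF assms(1)] prob_space.emeasure_space_1[OF assms(2)]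
    by (simp add: emeasure_mix_law flip: ennreal_plus)
qed

lemma integrable_mix_law:
  fixes g :: "'a \<Rightarrow> real"
  assumes S: "sets \<nu> = sets \<mu>" and g: "integrable \<mu> g" "integrable \<nu> g"
  shows "integrable (mix_law t \<mu> \<nu>) g"
proof (rule integrableI_bounded)
  have m: "borel_measurable (mix_law t \<mu> \<nu>) = borel_measurable \<mu>"
    by (auto intro: measurable_cong_sets)
  show "g \<in> borel_measurable (mix_law t \<mu> \<nu>)" using g m by auto
  have "(\<integral>\<^sup>+x. ennreal (norm (g x)) \<partial>mix_law t \<mu> \<nu>) =
     ennreal t * (\<integral>\<^sup>+x. ennreal (norm (g x)) \<partial>\<mu>) + ennreal (1 - t) * (\<integral>\<^sup>+x. ennreal (norm (g x)) \<partial>\<nu>)"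
    using g by (intro nn_integral_mix_law[OF S]) auto
  also have "\<dots> < \<infinity>"
    using g by (simp add: integrable_iff_bounded ennreal_mult_less_top)
  finally show "(\<integral>\<^sup>+x. ennreal (norm (g x)) \<partial>mix_law t \<mu> \<nu>) < \<infinity>" .
qed

lemma integral_mix_law:
  fixes g :: "'a \<Rightarrow> real"
  assumes S: "sets \<nu> = sets \<mu>" and g: "integrable \<mu> g" "integrable \<nu> g" and t: "0 \<le> t" "t \<le> 1"
  shows "(\<integral>x. g x \<partial>mix_law t \<mu> \<nu>) = t * (\<integral>x. g x \<partial>\<mu>) + (1 - t) * (\<integral>x. g x \<partial>\<nu>)"
proof -
  have *: "enn2real (\<integral>\<^sup>+x. ennreal (h x) \<partial>mix_law t \<mu> \<nu>) =
      t * enn2real (\<integral>\<^sup>+x. ennreal (h x) \<partial>\<mu>) + (1 - t) * enn2real (\<integral>\<^sup>+x. ennreal (h x) \<partial>\<nu>)"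
    if h: "integrable \<mu> h" "integrable \<nu> h" for h :: "'a \<Rightarrow> real"
  proof -
    have fin: "(\<integral>\<^sup>+x. ennreal (h x) \<partial>\<mu>) < \<infinity>" "(\<integral>\<^sup>+x. ennreal (h x) \<partial>\<nu>) < \<infinity>"
      using h by (auto simp: real_integrable_def less_top)
    have "(\<integral>\<^sup>+x. ennreal (h x) \<partial>mix_law t \<mu> \<nu>) =
      ennreal t * (\<integral>\<^sup>+x. ennreal (h x) \<partial>\<mu>) + ennreal (1 - t) * (\<integral>\<^sup>+x. ennreal (h x) \<partial>\<nu>)"
      using h by (intro nn_integral_mix_law[OF S]) auto
    then show ?thesis
      using fin t by (simp add: enn2real_plus enn2real_mult ennreal_mult_less_top)
  qed
  show ?thesis
    using *[of g] *[of "\<lambda>x. - g x"] g integrable_mix_law[OF S g, of t]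
    by (simp add: real_lebesgue_integral_def algebra_simps)
qed

lemma AE_mix_lawI:
  assumes S: "sets \<nu> = sets \<mu>" and P: "AE x in \<mu>. P x" "AE x in \<nu>. P x"
  shows "AE x in mix_law t \<mu> \<nu>. P x"
proof -
  have sp: "space \<nu> = space \<mu>" using S by (rule sets_eq_imp_space_eq)
  obtain N where N: "{x \<in> space \<mu>. \<not> P x} \<subseteq> N" "N \<in> sets \<mu>" "emeasure \<mu> N = 0"
    using P(1) by (rule AE_E)
  obtain N' where N': "{x \<in> space \<nu>. \<not> P x} \<subseteq> N'" "N' \<in> sets \<nu>" "emeasure \<nu> N' = 0"
    using P(2) by (rule AE_E)
  \<comment> \<open>The intersection is the right exceptional set: \<open>N\<close> may have
    positive \<open>\<nu>\<close>-measure and \<open>N'\<close> positive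
    \<open>\<mu>\<close>-measure, but both contain every point where \<open>P\<close> fails.\<close>
  have n: "emeasure \<mu> (N \<inter> N') = 0" "emeasure \<nu> (N \<inter> N') = 0"
    using N N' S by (metis Int_lower1 Int_lower2 emeasure_mono le_zero_eq)+
  show ?thesis
    by (rule AE_I[of _ _ "N \<inter> N'"])
      (use N N' n S sp in \<open>auto simp: emeasure_mix_law\<close>)
qed

text \<open>Laws are compared below through Bochner integrals of indicators, because the explicit
  formulas on circles are formulas for real integrals.\<close>

lemma prob_measure_eqI_integral:
  assumes M: "prob_space M" and N: "prob_space N" and S: "sets M = sets K" "sets N = sets K"
    and eq: "\<And>A. A \<in> sets K \<Longrightarrow> (\<integral>x. indicator A x \<partial>M) = (\<integral>x. (indicator A x :: real) \<partial>N)"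
  shows "M = N"
proof (rule measure_eqI)
  interpret M: prob_space M by fact
  interpret N: prob_space N by fact
  show "sets M = sets N" using S by simp
  fix A assume "A \<in> sets M"
  then show "emeasure M A = emeasure N A"
    using eq[of A] S sets.sets_into_space[of A M] sets.sets_into_space[of A N]
    by (simp add: M.emeasure_eq_measure N.emeasure_eq_measure Int_absorb2)
qed

section \<open>Spectral calculus of symmetric matrices of size two\<close>

lemma diag_mat_mult_right: "(W ** diag_mat d) $ i $ j = W $ i $ j * d $ j"
  by (simp add: matrix_matrix_mult_def diag_mat_def if_distrib[of "\<lambda>x. _ * x"] cong: if_cong)

lemma diag_mat_mult_left: "(diag_mat d ** W) $ i $ j = d $ i * W $ i $ j"
  by (simp add: matrix_matrix_mult_def diag_mat_def if_distrib[of "\<lambda>x. x * _"] cong: if_cong)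

text \<open>Well-definedness of the calculus. Two diagonalizations are linked by W =
  \<open>transpose Q ** P\<close>, which intertwines the diagonal matrices: each entry of W is zero
  or sits between equal eigenvalues. Hence W also intertwines the matrices with f applied.\<close>

lemma matrix_fun_eq:
  fixes P :: "real ^ 'n ^ 'n"
  assumes P: "orthogonal_matrix P" and H: "H = P ** diag_mat d ** transpose P"
  shows "matrix_fun f H = P ** diag_mat (\<chi> i. f (d $ i)) ** transpose P"
  unfolding matrix_fun_def
proof (rule the_equality)
  show "\<exists>P' d'. orthogonal_matrix P' \<and> H = P' ** diag_mat d' ** transpose P' \<and>
      P ** diag_mat (\<chi> i. f (d $ i)) ** transpose P = P' ** diag_mat (\<chi> i. f (d' $ i)) ** transpose P'"
    using assms by blast
next
  fix A assume "\<exists>Q e. orthogonal_matrix Q \<and> H = Q ** diag_mat e ** transpose Q \<and>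
      A = Q ** diag_mat (\<chi> i. f (e $ i)) ** transpose Q"
  then obtain Q e where Q: "orthogonal_matrix Q" and HQ: "H = Q ** diag_mat e ** transpose Q"
    and A: "A = Q ** diag_mat (\<chi> i. f (e $ i)) ** transpose Q" by blast
  have PP: "transpose P ** P = mat 1" "P ** transpose P = mat 1"
    and QQ: "transpose Q ** Q = mat 1" "Q ** transpose Q = mat 1"
    using P Q by (auto simp: orthogonal_matrix_def)
  define W where "W = transpose Q ** P"
  have QW: "Q ** W = P" by (simp add: W_def matrix_mul_assoc QQ)
  have WP: "W ** transpose P = transpose Q" by (simp add: W_def matrix_mul_assoc[symmetric] PP)
  have "W ** diag_mat d = transpose Q ** (P ** diag_mat d ** transpose P) ** P"
    by (simp add: W_def matrix_mul_assoc[symmetric] PP)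
  also have "\<dots> = transpose Q ** (Q ** diag_mat e ** transpose Q) ** P"
    using H HQ by simp
  also have "\<dots> = (transpose Q ** Q) ** diag_mat e ** (transpose Q ** P)"
    by (simp only: matrix_mul_assoc)
  finally have comm: "W ** diag_mat d = diag_mat e ** W" by (simp add: W_def QQ)
  have ent: "W $ i $ j * d $ j = e $ i * W $ i $ j" for i j
    using comm by (metis diag_mat_mult_left diag_mat_mult_right)
  have fent: "W $ i $ j * f (d $ j) = f (e $ i) * W $ i $ j" for i j
    using ent[of i j] by (cases "W $ i $ j = 0") auto
  have "W ** diag_mat (\<chi> i. f (d $ i)) = diag_mat (\<chi> i. f (e $ i)) ** W"
    by (simp add: vec_eq_iff diag_mat_mult_left diag_mat_mult_right fent)
  then have "P ** diag_mat (\<chi> i. f (d $ i)) ** transpose P =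
      Q ** (diag_mat (\<chi> i. f (e $ i)) ** W) ** transpose P"
    by (metis QW matrix_mul_assoc)
  also have "\<dots> = A" by (simp add: A matrix_mul_assoc[symmetric] WP)
  finally show "A = P ** diag_mat (\<chi> i. f (d $ i)) ** transpose P" by simp
qed

lemma trace_matrix_fun:
  fixes P :: "real ^ 'n ^ 'n"
  assumes "orthogonal_matrix P" and "H = P ** diag_mat d ** transpose P"
  shows "trace (matrix_fun f H) = (\<Sum>i\<in>UNIV. f (d $ i))"
proof -
  have "trace (matrix_fun f H) = trace (P ** (diag_mat (\<chi> i. f (d $ i)) ** transpose P))"
    by (simp add: matrix_fun_eq[OF assms] matrix_mul_assoc)
  also have "\<dots> = trace (diag_mat (\<chi> i. f (d $ i)) ** (transpose P ** P))"
    by (subst trace_mul_sym) (simp add: matrix_mul_assoc)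
  also have "\<dots> = (\<Sum>i\<in>UNIV. f (d $ i))"
    using assms(1) by (simp add: orthogonal_matrix_def trace_def diag_mat_def)
  finally show ?thesis .
qed

section \<open>Unit circle, rotations and reflections of the plane\<close>

definition circ :: "real \<Rightarrow> real ^ 2" where
  "circ \<phi> = vector [cos \<phi>, sin \<phi>]"

definition rot :: "real \<Rightarrow> real ^ 2 ^ 2" where
  "rot \<phi> = vector [vector [cos \<phi>, - sin \<phi>], vector [sin \<phi>, cos \<phi>]]"

text \<open>The reflection in the line at angle \<open>\<phi> / 2\<close>.\<close>

definition reflection :: "real \<Rightarrow> real ^ 2 ^ 2" where
  "reflection \<phi> = vector [vector [cos \<phi>, sin \<phi>], vector [sin \<phi>, - cos \<phi>]]"

lemmas mat2_simps = vec_eq_iff forall_2 sum_2 matrix_matrix_mult_def matrix_vector_mult_def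
  transpose_def mat_def

lemma circ_nth [simp]: "circ \<phi> $ 1 = cos \<phi>" "circ \<phi> $ 2 = sin \<phi>"
  by (simp_all add: circ_def)

lemma norm_circ [simp]: "norm (circ \<phi>) = 1"
  by (simp add: norm_vec_def L2_set_def sum_2)

lemma circ_period: "circ (\<phi> + 2*pi) = circ \<phi>"
  by (simp add: circ_def)

lemma rot_mult_rot: "rot \<alpha> ** rot \<phi> = rot (\<phi> + \<alpha>)"
  and rot_mult_reflection: "rot \<alpha> ** reflection \<phi> = reflection (\<phi> + \<alpha>)"
  and reflection_mult_rot: "reflection \<alpha> ** rot \<phi> = reflection (\<alpha> - \<phi>)"
  and reflection_mult_reflection: "reflection \<alpha> ** reflection \<phi> = rot (\<alpha> - \<phi>)"
  by (simp_all add: mat2_simps rot_def reflection_def cos_add sin_add cos_diff sin_diff)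

lemma rot_mult_circ: "rot \<alpha> *v circ \<phi> = circ (\<phi> + \<alpha>)"
  and reflection_mult_circ: "reflection \<alpha> *v circ \<phi> = circ (\<alpha> - \<phi>)"
  by (simp_all add: mat2_simps rot_def reflection_def cos_add sin_add cos_diff sin_diff)

lemma orthogonal_rot: "orthogonal_matrix (rot \<phi>)"
  and orthogonal_reflection: "orthogonal_matrix (reflection \<phi>)"
  by (simp_all add: orthogonal_matrix_def mat2_simps rot_def reflection_def
       sin_cos_squared_add3 flip: power2_eq_square)

text \<open>The first column is a unit vector, which provides the angle; the determinant, 1 or -1,
  then decides the second column.\<close>

lemma orthogonal_2_cases:
  fixes U :: "real ^ 2 ^ 2"
  assumes "orthogonal_matrix U"
  obtains \<alpha> where "U = rot \<alpha>" | \<alpha> where "U = reflection \<alpha>"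
proof -
  define a b c d where abcd: "a = U $ 1 $ 1" "b = U $ 1 $ 2" "c = U $ 2 $ 1" "d = U $ 2 $ 2"
  have e: "a * a + c * c = 1" "b * b + d * d = 1" "a * b + c * d = 0"
    using assms by (auto simp: orthogonal_matrix_def mat2_simps abcd)
  obtain \<alpha> where \<alpha>: "a = cos \<alpha>" "c = sin \<alpha>"
    using e(1) sincos_total_2pi[of a c] by (metis power2_eq_square)
  have "(a * d - c * b)\<^sup>2 = 1" using e by algebra
  then have "a * d - c * b = 1 \<or> a * d - c * b = -1" by (simp add: power2_eq_1_iff)
  then show ?thesis
  proof
    assume "a * d - c * b = 1"
    then have "d = a" "b = - c" using e by algebra+
    then have "U = rot \<alpha>" using \<alpha> by (simp add: mat2_simps rot_def abcd)
    then show ?thesis by (rule that(1))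
  next
    assume "a * d - c * b = -1"
    then have "d = - a" "b = c" using e by algebra+
    then have "U = reflection \<alpha>" using \<alpha> by (simp add: mat2_simps reflection_def abcd)
    then show ?thesis by (rule that(2))
  qed
qed

lemma polar_2:
  fixes a b :: real
  obtains \<psi> where "a = sqrt (a\<^sup>2 + b\<^sup>2) * cos \<psi>" "b = sqrt (a\<^sup>2 + b\<^sup>2) * sin \<psi>"
proof (cases "a\<^sup>2 + b\<^sup>2 = 0")
  case True
  then have "a = 0 \<and> b = 0" by (simp add: sum_power2_eq_zero_iff)
  then show ?thesis using that by simp
next
  case False
  define w where "w = sqrt (a\<^sup>2 + b\<^sup>2)"
  have w: "w\<^sup>2 = a\<^sup>2 + b\<^sup>2" "w \<noteq> 0" using False by (auto simp: w_def)
  have "(a / w)\<^sup>2 + (b / w)\<^sup>2 = 1"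
    using w False by (simp add: power_divide add_divide_distrib[symmetric])
  then obtain \<psi> where "a / w = cos \<psi>" "b / w = sin \<psi>" using sincos_total_2pi by metis
  then show ?thesis using that w by (simp add: w_def field_simps)
qed

text \<open>The spectral gap of a symmetric matrix of size two is read off its traceless part, a
  multiple of a reflection.\<close>

lemma trace_matrix_fun_2:
  fixes H :: "real ^ 2 ^ 2"
  assumes sym: "H $ 1 $ 2 = H $ 2 $ 1"
  defines "m \<equiv> (H $ 1 $ 1 + H $ 2 $ 2) / 2"
    and "v \<equiv> sqrt (((H $ 1 $ 1 - H $ 2 $ 2) / 2)\<^sup>2 + (H $ 1 $ 2)\<^sup>2)"
  shows "trace (matrix_fun f H) = f (m + v) + f (m - v)"
proof -
  obtain \<psi> where \<psi>: "(H $ 1 $ 1 - H $ 2 $ 2) / 2 = v * cos \<psi>" "H $ 1 $ 2 = v * sin \<psi>"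
    using polar_2[of "(H $ 1 $ 1 - H $ 2 $ 2) / 2" "H $ 1 $ 2"] unfolding v_def by metis
  \<comment> \<open>The traceless part is \<open>v\<close> times the reflection with parameter
    \<psi>, so its axis, an eigenvector, lies at half that angle.\<close>
  define \<theta> where "\<theta> = \<psi> / 2"
  have c: "cos \<psi> = (cos \<theta>)\<^sup>2 - (sin \<theta>)\<^sup>2" and s: "sin \<psi> = 2 * sin \<theta> * cos \<theta>"
    using cos_double[of \<theta>] sin_double[of \<theta>] by (auto simp: \<theta>_def)
  have one: "(cos \<theta>)\<^sup>2 + (sin \<theta>)\<^sup>2 = 1" by simp
  define d :: "real ^ 2" where "d = vector [m + v, m - v]"
  have h: "H $ 1 $ 1 = m + v * cos \<psi>" "H $ 2 $ 2 = m - v * cos \<psi>"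
    using \<psi> by (simp_all add: m_def field_simps)
  have m1: "m * (cos \<theta> * cos \<theta>) + m * (sin \<theta> * sin \<theta>) = m" using one by algebra
  have "H = rot \<theta> ** diag_mat d ** transpose (rot \<theta>)"
    using h \<psi> sym unfolding c s
    by (simp add: m1 mat2_simps rot_def diag_mat_def d_def algebra_simps power2_eq_square)
  from trace_matrix_fun[OF orthogonal_rot this]
  show ?thesis by (simp add: sum_2 d_def)
qed

text \<open>In double angles, \<open>outer (sqrt (2 * r) *\<^sub>R circ \<phi>)\<close> is r times
  the identity plus \<open>reflection (2 * \<phi>)\<close>. The traceless part therefore adds planar
  vectors of lengths r and s at angles \<open>2 * \<phi>\<close> and \<open>2 * \<psi>\<close>, and
  the law of cosines gives the spectral gap.\<close>

lemma trace_matrix_fun_circ: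
  assumes "0 \<le> r" "0 \<le> s"
  shows "trace (matrix_fun f ((1/2) *\<^sub>R (outer (sqrt (2 * r) *\<^sub>R circ \<phi>) + outer (sqrt (2 * s) *\<^sub>R circ \<psi>)))) =
     f ((r + s) / 2 + sqrt (r\<^sup>2 + s\<^sup>2 + 2 * r * s * cos (2*(\<psi> - \<phi>))) / 2) +
     f ((r + s) / 2 - sqrt (r\<^sup>2 + s\<^sup>2 + 2 * r * s * cos (2*(\<psi> - \<phi>))) / 2)"
proof -
  let ?H = "(1/2) *\<^sub>R (outer (sqrt (2 * r) *\<^sub>R circ \<phi>) + outer (sqrt (2 * s) *\<^sub>R circ \<psi>))"
  have H: "?H $ 1 $ 1 = r * (cos \<phi>)\<^sup>2 + s * (cos \<psi>)\<^sup>2" "?H $ 2 $ 2 = r * (sin \<phi>)\<^sup>2 + s * (sin \<psi>)\<^sup>2"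
    "?H $ 1 $ 2 = r * (cos \<phi> * sin \<phi>) + s * (cos \<psi> * sin \<psi>)" "?H $ 2 $ 1 = ?H $ 1 $ 2"
    using assms by (simp_all add: outer_def power2_eq_square algebra_simps)
  have m: "(?H $ 1 $ 1 + ?H $ 2 $ 2) / 2 = (r + s) / 2"
    unfolding H by (simp add: cos_squared_eq algebra_simps)
  have A: "(?H $ 1 $ 1 - ?H $ 2 $ 2) / 2 = (r * cos (2*\<phi>) + s * cos (2*\<psi>)) / 2"
    unfolding H cos_double by (simp add: algebra_simps)
  have B: "?H $ 1 $ 2 = (r * sin (2*\<phi>) + s * sin (2*\<psi>)) / 2"
    unfolding H sin_double by (simp add: algebra_simps)
  have "((?H $ 1 $ 1 - ?H $ 2 $ 2) / 2)\<^sup>2 + (?H $ 1 $ 2)\<^sup>2 =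
      (r\<^sup>2 + s\<^sup>2 + 2 * r * s * cos (2*(\<psi> - \<phi>))) / 4"
  proof -
    have "cos (2*(\<psi> - \<phi>)) = cos (2*\<psi>) * cos (2*\<phi>) + sin (2*\<psi>) * sin (2*\<phi>)"
      by (simp add: cos_diff right_diff_distrib)
    moreover have "(cos (2*\<phi>))\<^sup>2 + (sin (2*\<phi>))\<^sup>2 = 1" "(cos (2*\<psi>))\<^sup>2 + (sin (2*\<psi>))\<^sup>2 = 1" by simp_all
    ultimately show ?thesis unfolding A B power_divide by algebra
  qed
  then have v: "sqrt (((?H $ 1 $ 1 - ?H $ 2 $ 2) / 2)\<^sup>2 + (?H $ 1 $ 2)\<^sup>2) =
      sqrt (r\<^sup>2 + s\<^sup>2 + 2 * r * s * cos (2*(\<psi> - \<phi>))) / 2"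
    by (simp only: real_sqrt_divide real_sqrt_four)
  show ?thesis
    using trace_matrix_fun_2[of ?H f] H(4) unfolding m v by simp
qed

section \<open>Haar measure on the orthogonal group of the plane\<close>

text \<open>As a combination of two constant vectors with coefficients cos and sin, the map is
  visibly continuous; \<open>rot\<close> and \<open>reflection\<close> are treated alike.\<close>

lemma circ_measurable [measurable]: "circ \<in> borel_measurable borel"
proof -
  have eq: "circ = (\<lambda>\<phi>. cos \<phi> *\<^sub>R circ 0 + sin \<phi> *\<^sub>R circ (pi/2))"
    by (simp add: fun_eq_iff mat2_simps)
  show ?thesis
    by (subst eq) (intro borel_measurable_continuous_onI continuous_intros)
qed

lemma rot_measurable [measurable]: "rot \<in> borel_measurable borel"
proof -
  have eq: "rot = (\<lambda>\<phi>. cos \<phi> *\<^sub>R rot 0 + sin \<phi> *\<^sub>R rot (pi/2))"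
    by (simp add: fun_eq_iff mat2_simps rot_def)
  show ?thesis
    by (subst eq) (intro borel_measurable_continuous_onI continuous_intros)
qed

lemma reflection_measurable [measurable]: "reflection \<in> borel_measurable borel"
proof -
  have eq: "reflection = (\<lambda>\<phi>. cos \<phi> *\<^sub>R reflection 0 + sin \<phi> *\<^sub>R reflection (pi/2))"
    by (simp add: fun_eq_iff mat2_simps reflection_def)
  show ?thesis
    by (subst eq) (intro borel_measurable_continuous_onI continuous_intros)
qed

lemma rot_period: "rot (\<phi> + 2*pi) = rot \<phi>" and reflection_period: "reflection (\<phi> + 2*pi) = reflection \<phi>"
  by (simp_all add: rot_def reflection_def)

section \<open>Measurability of matrix operations\<close>

lemma measurable_matrix_mult [measurable]:
  fixes f :: "'a \<Rightarrow> real ^ 'n ^ 'n" and g :: "'a \<Rightarrow> real ^ 'n ^ 'n"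
  assumes "f \<in> borel_measurable M" "g \<in> borel_measurable M"
  shows "(\<lambda>x. f x ** g x) \<in> borel_measurable M"
proof (rule borel_measurable_continuous_Pair[OF assms])
  show "continuous_on UNIV (\<lambda>x :: (real ^ 'n ^ 'n) \<times> (real ^ 'n ^ 'n). fst x ** snd x)"
    unfolding matrix_matrix_mult_def by (intro continuous_on_vec_lambda continuous_intros)
qed

lemma measurable_matrix_vector_mult [measurable]:
  fixes f :: "'a \<Rightarrow> real ^ 'n ^ 'n" and g :: "'a \<Rightarrow> real ^ 'n"
  assumes "f \<in> borel_measurable M" "g \<in> borel_measurable M"
  shows "(\<lambda>x. f x *v g x) \<in> borel_measurable M"
proof (rule borel_measurable_continuous_Pair[OF assms])
  show "continuous_on UNIV (\<lambda>x :: (real ^ 'n ^ 'n) \<times> (real ^ 'n). fst x *v snd x)"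
    unfolding matrix_vector_mult_def by (intro continuous_on_vec_lambda continuous_intros)
qed

lemma measurable_transpose [measurable]:
  fixes f :: "'a \<Rightarrow> real ^ 'n ^ 'n"
  assumes "f \<in> borel_measurable M"
  shows "(\<lambda>x. transpose (f x)) \<in> borel_measurable M"
proof (rule borel_measurable_continuous_on[OF _ assms])
  show "continuous_on UNIV (transpose :: real ^ 'n ^ 'n \<Rightarrow> _)"
    unfolding transpose_def by (intro continuous_on_vec_lambda continuous_intros)
qed

lemma measurable_matrix_mult_left [measurable]:
  fixes U :: "real ^ 'n ^ 'n"
  shows "((**) U :: real ^ 'n ^ 'n \<Rightarrow> _) \<in> borel_measurable borel"
  by (rule measurable_matrix_mult[OF borel_measurable_const measurable_ident_sets[OF refl]])

lemma measurable_matrix_vector_mult_left [measurable]: "(*v) U \<in> borel_measurable borel"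
  for U :: "real ^ 'n ^ 'n"
  by (rule measurable_matrix_vector_mult[OF borel_measurable_const measurable_ident_sets[OF refl]])

lemma measurable_transpose_borel [measurable]:
  "(transpose :: real ^ 'n ^ 'n \<Rightarrow> _) \<in> borel_measurable borel"
  by (rule measurable_transpose[OF measurable_ident_sets[OF refl]])

lemma distr_mix_law:
  assumes S: "sets \<nu> = sets \<mu>" and g: "g \<in> \<mu> \<rightarrow>\<^sub>M N"
  shows "distr (mix_law t \<mu> \<nu>) N g = mix_law t (distr \<mu> N g) (distr \<nu> N g)"
proof (rule measure_eqI)
  fix A assume "A \<in> sets (distr (mix_law t \<mu> \<nu>) N g)"
  then have A: "A \<in> sets N" by simp
  have sp: "space \<nu> = space \<mu>" using S by (rule sets_eq_imp_space_eq)
  have g': "g \<in> \<nu> \<rightarrow>\<^sub>M N" "g \<in> mix_law t \<mu> \<nu> \<rightarrow>\<^sub>M N"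
    using g S by (auto cong: measurable_cong_sets)
  show "emeasure (distr (mix_law t \<mu> \<nu>) N g) A = emeasure (mix_law t (distr \<mu> N g) (distr \<nu> N g)) A"
    using A g g' S sp by (simp add: emeasure_distr emeasure_mix_law measurable_sets)
qed simp

lemma mix_law_half_commute:
  assumes S: "sets \<nu> = sets \<mu>"
  shows "mix_law (1/2) \<mu> \<nu> = mix_law (1/2) \<nu> \<mu>"
  by (rule measure_eqI) (use S in \<open>auto simp: emeasure_mix_law add.commute\<close>)

text \<open>The orthogonal group of the plane has two components, each a circle. They get equal
  weight because multiplication by a reflection exchanges them.\<close>

definition haar2 :: "(real ^ 2 ^ 2) measure" where
  "haar2 = mix_law (1/2) (distr unif borel rot) (distr unif borel reflection)"

lemma sets_haar2 [simp, measurable_cong]: "sets haar2 = sets borel"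
  by (simp add: haar2_def)

lemma prob_space_haar2: "prob_space haar2"
  unfolding haar2_def
  by (intro prob_space_mix_law prob_space.prob_space_distr[OF prob_space_unif]) auto

text \<open>A rotation shifts the angle on each component. A reflection swaps the components and
  reverses the angle, whence the commutation of the two halves of the mixture.\<close>

lemma distr_haar2:
  assumes U: "orthogonal_matrix U"
  shows "distr haar2 borel ((**) U) = haar2"
proof -
  have d: "distr haar2 borel ((**) U) =
      mix_law (1/2) (distr unif borel (\<lambda>\<phi>. U ** rot \<phi>)) (distr unif borel (\<lambda>\<phi>. U ** reflection \<phi>))"
    unfolding haar2_def by (subst distr_mix_law) (simp_all add: distr_distr comp_def)
  show ?thesis
  proof (rule orthogonal_2_cases[OF U])
    fix \<alpha> assume "U = rot \<alpha>"
    then show ?thesis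
      unfolding d using distr_unif_shift[of rot borel \<alpha>] distr_unif_shift[of reflection borel \<alpha>]
      by (simp add: rot_mult_rot rot_mult_reflection rot_period reflection_period haar2_def)
  next
    fix \<alpha> assume "U = reflection \<alpha>"
    then show ?thesis
      unfolding d using distr_unif_reflect[of rot borel \<alpha>] distr_unif_reflect[of reflection borel \<alpha>]
        mix_law_half_commute[of "distr unif borel rot" "distr unif borel reflection"]
      by (simp add: reflection_mult_rot reflection_mult_reflection rot_period reflection_period haar2_def)
  qed
qed

lemma is_haar_haar2: "is_haar_orthogonal haar2"
  unfolding is_haar_orthogonal_def
proof (intro conjI allI impI)
  show "haar2 \<in> laws" by (simp add: laws_def prob_space_haar2)
  have [measurable]: "Measurable.pred borel (\<lambda>U :: real ^ 2 ^ 2. orthogonal_matrix U)"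
    unfolding orthogonal_matrix by measurable
  show "AE U in haar2. orthogonal_matrix U"
    unfolding haar2_def
    by (rule AE_mix_lawI) (simp_all add: AE_distr_iff orthogonal_rot orthogonal_reflection)
qed (rule distr_haar2)

text \<open>The convolution of the transpose of \<open>\<mu>\<close> with \<open>\<nu>\<close> collapses to either factor.\<close>

lemma haar_eq_distr_transpose:
  fixes \<mu> \<nu> :: "(real ^ 'n ^ 'n) measure"
  assumes \<mu>: "is_haar_orthogonal \<mu>" and \<nu>: "is_haar_orthogonal \<nu>"
  shows "\<nu> = distr \<mu> borel transpose"
proof (rule measure_eqI)
  have S [simp, measurable_cong]: "sets \<mu> = sets borel" "sets \<nu> = sets borel"
    and prob: "prob_space \<mu>" "prob_space \<nu>"
    and ae: "AE U in \<mu>. orthogonal_matrix U" "AE U in \<nu>. orthogonal_matrix U"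
    and inv: "\<And>U. orthogonal_matrix U \<Longrightarrow> distr \<mu> borel ((**) U) = \<mu>"
      "\<And>U. orthogonal_matrix U \<Longrightarrow> distr \<nu> borel ((**) U) = \<nu>"
    using \<mu> \<nu> by (auto simp: is_haar_orthogonal_def laws_def)
  interpret \<mu>: prob_space \<mu> by fact
  interpret \<nu>: prob_space \<nu> by fact
  interpret pair_sigma_finite \<mu> \<nu> ..
  show "sets \<nu> = sets (distr \<mu> borel transpose)" by simp
  fix A assume "A \<in> sets \<nu>"
  then have [measurable]: "A \<in> sets borel" by simp
  have left: "(\<integral>\<^sup>+Y. indicator A (transpose X ** Y) \<partial>\<nu>) = emeasure \<nu> A" if X: "orthogonal_matrix X" for X
  proof -
    have "(\<integral>\<^sup>+Y. indicator A (transpose X ** Y) \<partial>\<nu>) = (\<integral>\<^sup>+Y. indicator A Y \<partial>distr \<nu> borel ((**) (transpose X)))"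
      by (subst nn_integral_distr) auto
    also have "\<dots> = emeasure \<nu> A" using X by (simp add: inv)
    finally show ?thesis .
  qed
  \<comment> \<open>Only left invariance is available. Since \<open>transpose X ** Y\<close> is the
    transpose of \<open>transpose Y ** X\<close>, the right factor becomes a left multiplication of
    X.\<close>
  have right: "(\<integral>\<^sup>+X. indicator A (transpose X ** Y) \<partial>\<mu>) = emeasure (distr \<mu> borel transpose) A"
    if Y: "orthogonal_matrix Y" for Y
  proof -
    have "(\<integral>\<^sup>+X. indicator A (transpose X ** Y) \<partial>\<mu>) = (\<integral>\<^sup>+X. indicator A (transpose (transpose Y ** X)) \<partial>\<mu>)"
      by (simp add: matrix_transpose_mul)
    also have "\<dots> = (\<integral>\<^sup>+X. indicator A (transpose X) \<partial>distr \<mu> borel ((**) (transpose Y)))"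
      by (subst nn_integral_distr) auto
    also have "\<dots> = (\<integral>\<^sup>+X. indicator A (transpose X) \<partial>\<mu>)" using Y by (simp add: inv)
    also have "\<dots> = (\<integral>\<^sup>+X. indicator A X \<partial>distr \<mu> borel transpose)"
      by (subst nn_integral_distr) auto
    also have "\<dots> = emeasure (distr \<mu> borel transpose) A" by simp
    finally show ?thesis .
  qed
  have "emeasure \<nu> A = (\<integral>\<^sup>+X. \<integral>\<^sup>+Y. indicator A (transpose X ** Y) \<partial>\<nu> \<partial>\<mu>)"
  proof -
    have "(\<integral>\<^sup>+X. \<integral>\<^sup>+Y. indicator A (transpose X ** Y) \<partial>\<nu> \<partial>\<mu>) = (\<integral>\<^sup>+X. emeasure \<nu> A \<partial>\<mu>)"
    proof (rule nn_integral_cong_AE)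
      show "AE X in \<mu>. (\<integral>\<^sup>+Y. indicator A (transpose X ** Y) \<partial>\<nu>) = emeasure \<nu> A"
        using ae(1) by eventually_elim (rule left)
    qed
    then show ?thesis by (simp add: \<mu>.emeasure_space_1)
  qed
  also have "\<dots> = (\<integral>\<^sup>+Y. \<integral>\<^sup>+X. indicator A (transpose X ** Y) \<partial>\<mu> \<partial>\<nu>)"
    by (rule Fubini'[symmetric]) measurable
  also have "\<dots> = emeasure (distr \<mu> borel transpose) A"
  proof -
    have "(\<integral>\<^sup>+Y. \<integral>\<^sup>+X. indicator A (transpose X ** Y) \<partial>\<mu> \<partial>\<nu>) = (\<integral>\<^sup>+Y. emeasure (distr \<mu> borel transpose) A \<partial>\<nu>)"
    proof (rule nn_integral_cong_AE)
      show "AE Y in \<nu>. (\<integral>\<^sup>+X. indicator A (transpose X ** Y) \<partial>\<mu>) = emeasure (distr \<mu> borel transpose) A"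
        using ae(2) by eventually_elim (rule right)
    qed
    then show ?thesis by (simp add: \<nu>.emeasure_space_1)
  qed
  finally show "emeasure \<nu> A = emeasure (distr \<mu> borel transpose) A" .
qed

text \<open>Every Haar measure is the image of \<open>haar2\<close> under transposition, and so is
  \<open>haar2\<close> itself.\<close>

lemma haar_orthogonal_eq_haar2: "haar_orthogonal = haar2"
  unfolding haar_orthogonal_def
proof (rule the_equality)
  show "is_haar_orthogonal haar2" by (rule is_haar_haar2)
  fix \<mu> :: "(real ^ 2 ^ 2) measure" assume "is_haar_orthogonal \<mu>"
  from haar_eq_distr_transpose[OF is_haar_haar2 this]
  show "\<mu> = haar2"
    by (rule trans[OF _ haar_eq_distr_transpose[OF is_haar_haar2 is_haar_haar2, symmetric]])
qed

section \<open>Functions without high modes are affine\<close>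

lemma compose_cos_bounded:
  fixes g :: "real \<Rightarrow> real"
  assumes "continuous_on UNIV g"
  obtains B where "\<And>x. \<bar>g (cos x)\<bar> \<le> B"
proof -
  have "compact (g ` {-1..1})"
    by (rule compact_continuous_image) (use assms in \<open>auto intro: continuous_on_subset\<close>)
  then obtain B where "\<And>y. y \<in> g ` {-1..1} \<Longrightarrow> norm y \<le> B"
    using compact_imp_bounded bounded_iff by metis
  then show ?thesis by (intro that[of B]) auto
qed

text \<open>A factor \<open>cos (2*x)\<close> turns mode k into the half-sum of modes k + 1 and k -
  1. Hence modes are indexed by integers and k varies in the induction.\<close>

lemma orthogonal_to_powers:
  fixes G :: "real \<Rightarrow> real" and k :: int
  assumes cont: "continuous_on UNIV G"
    and orth: "\<And>k::int. (\<integral>x. G (cos (2*x)) * cos (2 * of_int k * x) \<partial>unif) = 0"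
  shows "(\<integral>x. G (cos (2*x)) * cos (2*x) ^ n * cos (2 * of_int k * x) \<partial>unif) = 0"
proof (induction n arbitrary: k)
  case 0
  then show ?case by (simp add: orth)
next
  case (Suc n)
  obtain B where B: "\<And>x. \<bar>G (cos x)\<bar> \<le> B" using compose_cos_bounded[OF cont] by blast
  have [measurable]: "G \<in> borel_measurable borel" using cont by (rule borel_measurable_continuous_onI)
  have int: "integrable unif (\<lambda>x. G (cos (2*x)) * cos (2*x) ^ n * cos (2 * of_int j * x))" for j :: int
  proof (rule integrable_unif[where B = "B * 1 * 1"])
    show "\<bar>G (cos (2*x)) * cos (2*x) ^ n * cos (2 * of_int j * x)\<bar> \<le> B * 1 * 1" for x
      unfolding abs_mult power_abs
      using B[of 0] by (intro mult_mono B power_le_one) auto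
  qed measurable
  have eq: "G (cos (2*x)) * cos (2*x) ^ Suc n * cos (2 * of_int k * x) =
      (G (cos (2*x)) * cos (2*x) ^ n * cos (2 * of_int (k + 1) * x) +
       G (cos (2*x)) * cos (2*x) ^ n * cos (2 * of_int (k - 1) * x)) / 2" for x
  proof -
    have "cos (2*x) * cos (2 * of_int k * x) =
        (cos (2 * of_int (k + 1) * x) + cos (2 * of_int (k - 1) * x)) / 2" 
      by (subst mult.commute[of "cos (2*x)"], subst cos_times_cos) (simp add: algebra_simps)
    then have "G (cos (2*x)) * cos (2*x) ^ n * (cos (2*x) * cos (2 * of_int k * x)) =
        G (cos (2*x)) * cos (2*x) ^ n * ((cos (2 * of_int (k + 1) * x) + cos (2 * of_int (k - 1) * x)) / 2)"
      by simp
    then show ?thesis by (simp only: power_Suc2 mult.assoc distrib_left add_divide_distrib times_divide_eq_right)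
  qed
  show ?case
    unfolding eq using int[of "k + 1"] int[of "k - 1"] Suc.IH[of "k + 1"] Suc.IH[of "k - 1"]
    by (simp del: of_int_add of_int_diff)
qed

text \<open>\<open>G\<close> is orthogonal to all polynomials in \<open>cos (2*x)\<close> and, by
  Weierstrass, is a uniform limit of such polynomials on [-1, 1]. So its mean square is 0, and
  continuity upgrades almost everywhere to everywhere.\<close>

lemma orthogonal_to_all_imp_zero:
  fixes G :: "real \<Rightarrow> real"
  assumes cont: "continuous_on UNIV G"
    and orth: "\<And>k::int. (\<integral>x. G (cos (2*x)) * cos (2 * of_int k * x) \<partial>unif) = 0"
    and t: "-1 \<le> t" "t \<le> 1"
  shows "G t = 0"
proof -
  obtain B where B: "\<And>x. \<bar>G (cos x)\<bar> \<le> B" using compose_cos_bounded[OF cont] by blast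
  have B0: "0 \<le> B" using B[of 0] by simp
  have [measurable]: "G \<in> borel_measurable borel" using cont by (rule borel_measurable_continuous_onI)
  interpret prob_space unif by (rule prob_space_unif)
  have int: "integrable unif (\<lambda>x. G (cos (2*x)) * h (cos (2*x)))"
    if h: "continuous_on UNIV h" for h :: "real \<Rightarrow> real"
  proof -
    obtain C where C: "\<And>x. \<bar>h (cos x)\<bar> \<le> C" using compose_cos_bounded[OF h] by blast
    have [measurable]: "h \<in> borel_measurable borel" using h by (rule borel_measurable_continuous_onI)
    show ?thesis
      by (rule integrable_unif[where B = "B * C"]) (auto simp: abs_mult B0 intro!: mult_mono B C)
  qed
  let ?I = "\<integral>x. G (cos (2*x)) * G (cos (2*x)) \<partial>unif"
  have "?I \<le> B * e" if e: "0 < e" for e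
  proof -
    obtain p where p: "real_polynomial_function p" "\<And>x. x \<in> {-1..1} \<Longrightarrow> \<bar>G x - p x\<bar> < e"
      using Stone_Weierstrass_real_polynomial_function[of "{-1..1}" G e] e cont
      by (metis compact_Icc continuous_on_subset subset_UNIV)
    obtain a n where pa: "p = (\<lambda>x. \<Sum>i\<le>n. a i * x ^ i)"
      using p(1) real_polynomial_function_imp_sum by blast
    have contp: "continuous_on UNIV p" unfolding pa by (intro continuous_intros)
    have mono: "(\<integral>x. G (cos (2*x)) * cos (2*x) ^ i \<partial>unif) = 0" for i
      using orthogonal_to_powers[OF cont orth, of i 0] by simp
    have "G (cos (2*x)) * p (cos (2*x)) = (\<Sum>i\<le>n. a i * (G (cos (2*x)) * cos (2*x) ^ i))" for x
      by (simp add: pa sum_distrib_left mult_ac)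
    then have "(\<integral>x. G (cos (2*x)) * p (cos (2*x)) \<partial>unif) = (\<Sum>i\<le>n. a i * (\<integral>x. G (cos (2*x)) * cos (2*x) ^ i \<partial>unif))"
      using int[of "\<lambda>t. t ^ _"] by (simp add: continuous_on_power)
    also have "\<dots> = 0" by (simp add: mono)
    finally have p0: "(\<integral>x. G (cos (2*x)) * p (cos (2*x)) \<partial>unif) = 0" .
    \<comment> \<open>Subtracting the vanishing integral of G p replaces one factor G by the small
      difference G - p.\<close>
    have "?I = (\<integral>x. G (cos (2*x)) * G (cos (2*x)) - G (cos (2*x)) * p (cos (2*x)) \<partial>unif)"
      using p0 int[OF cont] int[OF contp] by simp
    also have "\<dots> \<le> (\<integral>x. B * e \<partial>unif)"
    proof (rule integral_mono)
      show "integrable unif (\<lambda>x. G (cos (2*x)) * G (cos (2*x)) - G (cos (2*x)) * p (cos (2*x)))"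
        using int[OF cont] int[OF contp] by simp
      fix x
      have "G (cos (2*x)) * G (cos (2*x)) - G (cos (2*x)) * p (cos (2*x)) =
          G (cos (2*x)) * (G (cos (2*x)) - p (cos (2*x)))" by (simp add: algebra_simps)
      also have "\<dots> \<le> \<bar>G (cos (2*x))\<bar> * \<bar>G (cos (2*x)) - p (cos (2*x))\<bar>"
        by (metis abs_ge_self abs_mult)
      also have "\<dots> \<le> B * e"
        using p(2)[of "cos (2*x)"] by (intro mult_mono B) (auto simp: B0 less_imp_le)
      finally show "G (cos (2*x)) * G (cos (2*x)) - G (cos (2*x)) * p (cos (2*x)) \<le> B * e" .
    qed simp
    finally show ?thesis using prob_space by simp
  qed
  then have le: "?I \<le> B * e" if "0 < e" for e using that by blast
  have "?I \<le> 0 + d" if d: "0 < d" for d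
  proof -
    have "?I \<le> B * (d / (B + 1))" using B0 d by (intro le divide_pos_pos) auto
    also have "\<dots> \<le> d" using B0 d by (simp add: field_simps)
    finally show ?thesis by simp
  qed
  then have "?I \<le> 0" by (rule field_le_epsilon)
  moreover have "0 \<le> ?I" by (rule Bochner_Integration.integral_nonneg) simp
  ultimately have "?I = 0" by simp
  then have "AE x in unif. G (cos (2*x)) = 0"
    using integral_nonneg_eq_0_iff_AE[OF int[OF cont]] by simp
  then have ae: "AE x in lborel. x \<in> {0..<2*pi} \<longrightarrow> G (cos (2*x)) = 0"
    unfolding unif_def by (subst (asm) AE_uniform_measure) auto
  \<comment> \<open>A null open set is empty.\<close>
  let ?S = "{0<..<2*pi} \<inter> {x. G (cos (2*x)) \<noteq> 0}"
  have cc: "continuous_on UNIV (\<lambda>x. G (cos (2*x)))"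
    by (rule continuous_on_compose2[OF cont]) (auto intro!: continuous_intros)
  have "open {x. G (cos (2*x)) \<noteq> 0}"
    by (rule open_Collect_neq[OF cc continuous_on_const])
  then have op: "open ?S" by auto
  have "?S = {}"
  proof (rule ccontr)
    assume ne: "?S \<noteq> {}"
    have "AE x in lborel. x \<notin> ?S" using ae by eventually_elim auto
    then have "?S \<in> null_sets lborel" using op by (subst (asm) AE_iff_null_sets[symmetric]) auto
    then have "negligible ?S" using negligible_iff_null_sets null_sets_completionI by blast
    then show False using open_not_negligible[OF op ne] by simp
  qed
  \<comment> \<open>A preimage of \<open>t\<close> under \<open>cos (2*x)\<close>. The summand pi
    keeps it inside the open window also for \<open>t = 1\<close>, where \<open>arccos t / 2\<close>
    is the endpoint 0.\<close>
  moreover have "arccos t / 2 + pi \<in> {0<..<2*pi}"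
    using arccos_lbound[OF t] arccos_ubound[OF t] pi_gt_zero unfolding greaterThanLessThan_iff by linarith
  moreover have "cos (2 * (arccos t / 2 + pi)) = t"
  proof -
    have "2 * (arccos t / 2 + pi) = arccos t + 2 * pi" by simp
    then show ?thesis using t by (simp only: cos_periodic cos_arccos)
  qed
  ultimately show ?thesis by force
qed

text \<open>Subtract the projection onto modes 0 and 1, an affine function of
  \<open>cos (2*x)\<close>; all modes of the remainder vanish.\<close>

lemma affine_if_orthogonal_to_high_modes:
  fixes g :: "real \<Rightarrow> real"
  assumes cont: "continuous_on UNIV g"
    and orth: "\<And>k::nat. 2 \<le> k \<Longrightarrow> (\<integral>x. g (cos (2*x)) * cos (2 * real k * x) \<partial>unif) = 0"
  obtains a b where "\<And>t. -1 \<le> t \<Longrightarrow> t \<le> 1 \<Longrightarrow> g t = a + b * t"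
proof -
  define a where "a = (\<integral>x. g (cos (2*x)) \<partial>unif)"
  \<comment> \<open>The factor 2 compensates the mean 1/2 of the square of
    \<open>cos (2*x)\<close>.\<close>
  define b where "b = 2 * (\<integral>x. g (cos (2*x)) * cos (2*x) \<partial>unif)"
  define G where "G t = g t - (a + b * t)" for t
  have contG: "continuous_on UNIV G" unfolding G_def by (intro continuous_intros cont)
  obtain B where B: "\<And>x. \<bar>g (cos x)\<bar> \<le> B" using compose_cos_bounded[OF cont] by blast
  have [measurable]: "g \<in> borel_measurable borel" using cont by (rule borel_measurable_continuous_onI)
  have int: "integrable unif (\<lambda>x. g (cos (2*x)) * cos (c * x))" for c
  proof (rule integrable_unif[where B = "B * 1"])
    show "\<bar>g (cos (2*x)) * cos (c * x)\<bar> \<le> B * 1" for x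
      unfolding abs_mult using B[of 0] by (intro mult_mono B) auto
  qed measurable
  have int': "integrable unif (\<lambda>x. cos (d * x) * cos (c * x))" for c d
    by (rule integrable_unif[where B = 1])
      (auto simp: abs_mult intro!: mult_le_one)
  have *: "(\<integral>x. G (cos (2*x)) * cos (2 * of_int k * x) \<partial>unif) =
      (\<integral>x. g (cos (2*x)) * cos (2 * of_int k * x) \<partial>unif) - a * (\<integral>x. cos (2 * of_int k * x) \<partial>unif)
        - b * (\<integral>x. cos (2*x) * cos (2 * of_int k * x) \<partial>unif)" for k :: int
    using int[of "2 * of_int k"] int'[of 2 "2 * of_int k"] integrable_unif_trig(1)[of "2 * of_int k"]
    by (simp add: G_def left_diff_distrib distrib_right mult.assoc)
  have "(\<integral>x. G (cos (2*x)) * cos (2 * of_int k * x) \<partial>unif) = 0" for k :: int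
  proof -
    have nat: "(\<integral>x. G (cos (2*x)) * cos (2 * real k * x) \<partial>unif) = 0" for k :: nat
    proof -
      have c: "(\<integral>x. cos (2 * real k * x) \<partial>unif) = (if k = 0 then 1 else 0)"
        using integral_unif_cos[of "2 * int k"] by (auto simp del: lebesgue_integral_const)
      have cc: "(\<integral>x. cos (2*x) * cos (2 * real k * x) \<partial>unif) = (if k = 1 then 1/2 else 0)"
        using integral_unif_cos_cos[of 2 "2 * int k"] by auto
      consider "k = 0" | "k = 1" | "2 \<le> k" by linarith
      then show ?thesis
        using *[of "int k"] c cc orth[of k] by cases (auto simp: a_def b_def)
    qed
    show ?thesis
    proof (cases "0 \<le> k")
      case True then show ?thesis using nat[of "nat k"] by simp
    next
      case False
      then show ?thesis using nat[of "nat (- k)"] by simp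
    qed
  qed
  then have "G t = 0" if "-1 \<le> t" "t \<le> 1" for t
    using orthogonal_to_all_imp_zero[OF contG _ that] by blast
  then show ?thesis by (intro that[of a b]) (simp add: G_def)
qed

text \<open>An affine function with a finite limit is constant, so only the constants have no high modes
  at any scale.\<close>

lemma ex_high_mode:
  fixes f :: "real \<Rightarrow> real"
  assumes cont: "continuous_on UNIV f" and lim: "(f \<longlongrightarrow> L) at_top"
    and nc: "\<not> f constant_on {0..}"
  obtains s :: real and k :: nat where "0 < s" "2 \<le> k"
    "(\<integral>x. f (s * (1 - cos (2*x)) / 2) * cos (2 * real k * x) \<partial>unif) \<noteq> 0"
proof (rule ccontr)
  assume no: "\<not> thesis"
  note mode = that
  have orth: "(\<integral>x. f (s * (1 - cos (2*x)) / 2) * cos (2 * real k * x) \<partial>unif) = 0"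
    if "0 < s" "2 \<le> k" for s and k :: nat
    using mode no that by blast
  have aff: "f x = f 0 + x * (f 1 - f 0)" if "0 \<le> x" for x
  proof -
    \<comment> \<open>This choice puts 0, 1 and x into one interval [0, s] on which f is affine; the
      values at 0 and 1 then determine the value at x, independently of s.\<close>
    define s where "s = max x 1"
    have s: "0 < s" "x \<le> s" "1 \<le> s" by (auto simp: s_def)
    have c: "continuous_on UNIV (\<lambda>t. f (s * (1 - t) / 2))"
      by (rule continuous_on_compose2[OF cont]) (auto intro!: continuous_intros)
    obtain a b where ab: "\<And>t. -1 \<le> t \<Longrightarrow> t \<le> 1 \<Longrightarrow> f (s * (1 - t) / 2) = a + b * t"
      using affine_if_orthogonal_to_high_modes[OF c] orth[OF s(1)] by blast
    have fy: "f y = a + b * (1 - 2 * y / s)" if "0 \<le> y" "y \<le> s" for y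
      using ab[of "1 - 2 * y / s"] that s by (simp add: field_simps)
    show ?thesis
      using s that by (simp add: fy algebra_simps)
  qed
  have "f 1 = f 0"
  proof (rule ccontr)
    assume ne: "f 1 \<noteq> f 0"
    \<comment> \<open>With nonzero slope, the normalized function is eventually the identity, which
      has no finite limit.\<close>
    have "((\<lambda>x. (f x - f 0) / (f 1 - f 0)) \<longlongrightarrow> (L - f 0) / (f 1 - f 0)) at_top"
      using ne by (intro tendsto_intros lim) auto
    moreover have "\<forall>\<^sub>F x in at_top. (f x - f 0) / (f 1 - f 0) = x"
      using eventually_ge_at_top[of 0] by eventually_elim (use aff ne in \<open>simp add: field_simps\<close>)
    ultimately have "((\<lambda>x::real. x) \<longlongrightarrow> (L - f 0) / (f 1 - f 0)) at_top"
      by (rule Lim_transform_eventually)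
    moreover have "filterlim (\<lambda>x::real. x) at_top at_top" by (rule filterlim_ident)
    ultimately show False
      using filterlim_at_top_imp_at_infinity not_tendsto_and_filterlim_at_infinity trivial_limit_at_top_linorder
      by blast
  qed
  then show False using nc aff unfolding constant_on_def by (metis add.right_neutral atLeast_iff diff_self mult_zero_right)
qed

section \<open>Fourier coefficients of the two-point kernel\<close>

text \<open>The trace computed in \<open>trace_matrix_fun_circ\<close>, as a function of the angle
  difference.\<close>

definition spec_sum :: "(real \<Rightarrow> real) \<Rightarrow> real \<Rightarrow> real \<Rightarrow> real \<Rightarrow> real" where
  "spec_sum f r s \<phi> =
     f ((r + s) / 2 + sqrt (r\<^sup>2 + s\<^sup>2 + 2 * r * s * cos (2*\<phi>)) / 2) +
     f ((r + s) / 2 - sqrt (r\<^sup>2 + s\<^sup>2 + 2 * r * s * cos (2*\<phi>)) / 2)"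

lemma continuous_on_spec_sum:
  assumes "continuous_on UNIV f"
  shows "continuous_on UNIV (spec_sum f r s)"
  unfolding spec_sum_def
  by (intro continuous_intros continuous_on_compose2[OF assms]) auto

text \<open>Constant on the left, continuous on a compact middle part, close to \<open>L\<close> on
  the right. The condition on nonpositive arguments is the shape of the extension f (max 0
  x).\<close>

lemma bounded_if_limits:
  fixes f :: "real \<Rightarrow> real"
  assumes cont: "continuous_on UNIV f" and lim: "(f \<longlongrightarrow> L) at_top" and neg: "\<And>x. x \<le> 0 \<Longrightarrow> f x = f 0"
  obtains B where "\<And>x. \<bar>f x\<bar> \<le> B"
proof -
  have "\<forall>\<^sub>F x in at_top. dist (f x) L < 1" using lim by (rule tendstoD) simp
  then obtain N where N: "\<And>x. N \<le> x \<Longrightarrow> \<bar>f x - L\<bar> < 1"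
    unfolding eventually_at_top_linorder dist_real_def by blast
  have "compact (f ` {0..max 0 N})"
    by (rule compact_continuous_image) (use cont in \<open>auto intro: continuous_on_subset\<close>)
  then obtain C where C: "\<And>y. y \<in> f ` {0..max 0 N} \<Longrightarrow> norm y \<le> C"
    using compact_imp_bounded bounded_iff by metis
  have "\<bar>f x\<bar> \<le> max C (\<bar>L\<bar> + 1)" for x
  proof -
    consider "x \<le> 0" | "0 \<le> x" "x \<le> max 0 N" | "N \<le> x" by linarith
    then show ?thesis
    proof cases
      case 1
      then show ?thesis using neg[of x] C[of "f 0"] by force
    next
      case 2
      then show ?thesis using C[of "f x"] by force
    next
      case 3
      then show ?thesis using N[of x] by linarith
    qed
  qed
  then show ?thesis by (rule that)
qed

lemma one_plus_cos_nonneg: "0 \<le> 1 + cos (x::real)"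
  using cos_ge_minus_one[of x] by linarith

text \<open>The larger eigenvalue is at least R / 2. For the smaller one, with c =
  \<open>cos (2*\<phi>)\<close>, the root is R + s c + o(1), so R cancels and s (1 - c) / 2
  remains.\<close>

lemma tendsto_spec_sum_mixed:
  fixes f :: "real \<Rightarrow> real"
  assumes cont: "continuous_on UNIV f" and lim: "(f \<longlongrightarrow> L) at_top" and s: "0 < s"
  shows "((\<lambda>R. spec_sum f s R \<phi>) \<longlongrightarrow> L + f (s * (1 - cos (2*\<phi>)) / 2)) at_top"
  unfolding spec_sum_def
proof (rule tendsto_add)
  let ?w = "\<lambda>R. sqrt (s\<^sup>2 + R\<^sup>2 + 2 * s * R * cos (2*\<phi>))"
  have "filterlim (\<lambda>R. (s + R) / 2 + ?w R / 2) at_top at_top"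
  proof (rule filterlim_at_top_mono)
    show "filterlim (\<lambda>R::real. R / 2) at_top at_top" by real_asymp
    show "\<forall>\<^sub>F R in at_top. R / 2 \<le> (s + R) / 2 + ?w R / 2"
      using eventually_ge_at_top[of 0]
    proof eventually_elim
      case (elim R)
      have "(s - R)\<^sup>2 + 2 * s * R * (1 + cos (2*\<phi>)) = s\<^sup>2 + R\<^sup>2 + 2 * s * R * cos (2*\<phi>)"
        by (simp add: power2_eq_square algebra_simps)
      moreover have "0 \<le> 2 * s * R * (1 + cos (2*\<phi>))"
        by (rule mult_nonneg_nonneg) (use s elim one_plus_cos_nonneg[of "2*\<phi>"] in auto)
      ultimately have "0 \<le> s\<^sup>2 + R\<^sup>2 + 2 * s * R * cos (2*\<phi>)"
        using zero_le_power2[of "s - R"] by linarith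
      then have w: "0 \<le> ?w R" by simp
      have "R / 2 + 0 \<le> (s + R) / 2 + ?w R / 2" by (rule add_mono) (use w s in auto)
      then show ?case by simp
    qed
  qed
  then show "((\<lambda>R. f ((s + R) / 2 + ?w R / 2)) \<longlongrightarrow> L) at_top"
    by (rule filterlim_compose[OF lim])
  have "((\<lambda>R. (s + R) / 2 - sqrt (s\<^sup>2 + R\<^sup>2 + 2 * s * R * c) / 2) \<longlongrightarrow> s / 2 - s * c / 2) at_top" for c
    by real_asymp
  then have "((\<lambda>R. (s + R) / 2 - ?w R / 2) \<longlongrightarrow> s * (1 - cos (2*\<phi>)) / 2) at_top"
    by (simp add: right_diff_distrib diff_divide_distrib)
  moreover have "isCont f (s * (1 - cos (2*\<phi>)) / 2)"
    using cont by (simp add: continuous_on_eq_continuous_at)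
  ultimately show "((\<lambda>R. f ((s + R) / 2 - ?w R / 2)) \<longlongrightarrow> f (s * (1 - cos (2*\<phi>)) / 2)) at_top"
    by (rule isCont_tendsto_compose[rotated])
qed

text \<open>At equal radii the eigenvalues are R (1 + q) and R (1 - q), where q is the absolute
  value of \<open>cos \<phi>\<close>. Both escape unless q = 1, that is, unless the two columns are
  parallel.\<close>

lemma tendsto_spec_sum_diag:
  fixes f :: "real \<Rightarrow> real"
  assumes lim: "(f \<longlongrightarrow> L) at_top" and ne: "cos (2*\<phi>) \<noteq> 1"
  shows "((\<lambda>R. spec_sum f R R \<phi>) \<longlongrightarrow> L + L) at_top"
proof -
  define q where "q = sqrt ((1 + cos (2*\<phi>)) / 2)"
  have lt: "cos (2*\<phi>) < 1" using ne cos_le_one[of "2*\<phi>"] by linarith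
  have "q < 1" unfolding q_def using lt by (simp add: real_sqrt_less_iff[of _ 1, simplified])
  have q0: "0 \<le> q" unfolding q_def using one_plus_cos_nonneg[of "2*\<phi>"] by simp
  have eq: "\<forall>\<^sub>F R in at_top. f (R * (1 + q)) + f (R * (1 - q)) = spec_sum f R R \<phi>"
    using eventually_ge_at_top[of 0]
  proof eventually_elim
    case (elim R)
    have "R\<^sup>2 + R\<^sup>2 + 2 * R * R * cos (2*\<phi>) = (2 * R)\<^sup>2 * ((1 + cos (2*\<phi>)) / 2)"
      by (simp add: power2_eq_square algebra_simps)
    then have "sqrt (R\<^sup>2 + R\<^sup>2 + 2 * R * R * cos (2*\<phi>)) = 2 * R * q"
      using elim by (simp only: real_sqrt_mult q_def real_sqrt_abs abs_mult abs_numeral abs_of_nonneg)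
    then show ?case unfolding spec_sum_def by (simp add: algebra_simps)
  qed
  have a: "filterlim (\<lambda>R. R * (1 + q)) at_top at_top"
    by (rule filterlim_at_top_mult_tendsto_pos[OF tendsto_const _ filterlim_ident]) (use q0 in simp)
  have b: "filterlim (\<lambda>R. R * (1 - q)) at_top at_top"
    by (rule filterlim_at_top_mult_tendsto_pos[OF tendsto_const _ filterlim_ident]) (use \<open>q < 1\<close> in simp)
  have "((\<lambda>R. f (R * (1 + q)) + f (R * (1 - q))) \<longlongrightarrow> L + L) at_top"
    by (intro tendsto_add filterlim_compose[OF lim] a b)
  then show ?thesis using eq by (rule Lim_transform_eventually)
qed

text \<open>The mean against the cosine, so half the usual Fourier coefficient; the sine
  coefficients vanish because the kernel is even.\<close>

definition mode_coeff :: "(real \<Rightarrow> real) \<Rightarrow> nat \<Rightarrow> real \<Rightarrow> real \<Rightarrow> real" where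
  "mode_coeff f k r s = (\<integral>x. spec_sum f r s x * cos (2 * real k * x) \<partial>unif)"

text \<open>The angles of parallel columns are the multiples of pi, a countable set.\<close>

lemma AE_unif_cos_ne_1: "AE x in unif. cos (2*x) \<noteq> 1"
proof -
  have "AE x in lborel. x \<notin> range (\<lambda>n::int. of_int n * pi)"
    by (rule AE_not_in) (intro countable_imp_null_set_lborel countable_image, simp)
  then have "AE x in lborel. x \<in> {0..<2*pi} \<longrightarrow> cos (2*x) \<noteq> 1"
  proof eventually_elim
    case (elim x)
    show ?case
    proof (intro impI notI)
      assume "cos (2*x) = 1"
      then obtain n :: int where "2 * x = of_int n * 2 * pi" using cos_one_2pi_int by blast
      then have "x = of_int n * pi" by simp
      then show False using elim by blast
    qed
  qed
  then show ?thesis unfolding unif_def by (intro AE_uniform_measureI) auto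
qed

text \<open>Dominated convergence with the constant bound \<open>2 * B\<close>. The first radius is
  a function of R, so that both the mixed entry (constant s) and the outer diagonal entry (R itself)
  are covered.\<close>

lemma tendsto_mode_coeff:
  fixes f :: "real \<Rightarrow> real"
  assumes cont: "continuous_on UNIV f" and B: "\<And>x. \<bar>f x\<bar> \<le> B"
    and lim: "AE x in unif. ((\<lambda>R. spec_sum f (r R) R x) \<longlongrightarrow> g x) at_top"
    and [measurable]: "g \<in> borel_measurable borel"
  shows "((\<lambda>R. mode_coeff f k (r R) R) \<longlongrightarrow> (\<integral>x. g x * cos (2 * real k * x) \<partial>unif)) at_top"
  unfolding mode_coeff_def
proof (rule integral_dominated_convergence_at_top[where w = "\<lambda>_. 2 * B"])
  have [measurable]: "spec_sum f a b \<in> borel_measurable borel" for a b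
    by (rule borel_measurable_continuous_onI[OF continuous_on_spec_sum[OF cont]])
  show "(\<lambda>x. spec_sum f (r R) R x * cos (2 * real k * x)) \<in> borel_measurable unif" for R by simp
  show "(\<lambda>x. g x * cos (2 * real k * x)) \<in> borel_measurable unif" by simp
  show "integrable unif (\<lambda>_. 2 * B)" by (rule integrable_unif[where B = "\<bar>2 * B\<bar>"]) auto
  show "AE x in unif. ((\<lambda>R. spec_sum f (r R) R x * cos (2 * real k * x)) \<longlongrightarrow> g x * cos (2 * real k * x)) at_top"
    using lim by eventually_elim (intro tendsto_intros)
  show "\<forall>\<^sub>F R in at_top. AE x in unif. norm (spec_sum f (r R) R x * cos (2 * real k * x)) \<le> 2 * B"
  proof (intro always_eventually allI AE_I2)
    fix R x
    have "\<bar>spec_sum f (r R) R x\<bar> \<le> 2 * B"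
      unfolding spec_sum_def by (rule order_trans[OF abs_triangle_ineq]) (unfold mult_2, intro add_mono B)
    then have "\<bar>spec_sum f (r R) R x\<bar> * \<bar>cos (2 * real k * x)\<bar> \<le> 2 * B * 1"
      by (intro mult_mono) (use B[of 0] in auto)
    then show "norm (spec_sum f (r R) R x * cos (2 * real k * x)) \<le> 2 * B"
      by (simp add: abs_mult)
  qed
qed

text \<open>As the outer radius tends to infinity, the larger eigenvalue escapes and the mixed
  coefficient tends to \<open>\<beta>\<close>, while the outer diagonal coefficient tends to zero; a small weight
  on the inner radius then makes the quadratic form positive.\<close>

lemma ex_positive_direction:
  fixes f :: "real \<Rightarrow> real"
  assumes cont: "continuous_on UNIV f" and B: "\<And>x. \<bar>f x\<bar> \<le> B" and lim: "(f \<longlongrightarrow> L) at_top"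
    and s: "0 < s" and k: "0 < k"
    and beta: "(\<integral>x. f (s * (1 - cos (2*x)) / 2) * cos (2 * real k * x) \<partial>unif) \<noteq> 0"
  obtains R c d where "s < R" "\<bar>c\<bar> \<le> 1" "\<bar>d\<bar> \<le> 1"
    "c * c * mode_coeff f k s s + 2 * (c * d * mode_coeff f k s R) + d * d * mode_coeff f k R R > 0"
proof -
  define \<beta> where "\<beta> = (\<integral>x. f (s * (1 - cos (2*x)) / 2) * cos (2 * real k * x) \<partial>unif)"
  have [measurable]: "f \<in> borel_measurable borel" using cont by (rule borel_measurable_continuous_onI)
  have cos0: "(\<integral>x. cos (2 * real k * x) \<partial>unif) = 0"
    using integral_unif_cos[of "2 * int k"] k by simp
  have "((\<lambda>R. mode_coeff f k s R) \<longlongrightarrow>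
      (\<integral>x. (L + f (s * (1 - cos (2*x)) / 2)) * cos (2 * real k * x) \<partial>unif)) at_top"
    by (rule tendsto_mode_coeff[OF cont B]) (use tendsto_spec_sum_mixed[OF cont lim s] in auto)
  moreover have "(\<integral>x. (L + f (s * (1 - cos (2*x)) / 2)) * cos (2 * real k * x) \<partial>unif) = \<beta>"
  proof -
    have "integrable unif (\<lambda>x. f (s * (1 - cos (2*x)) / 2) * cos (2 * real k * x))"
    proof (rule integrable_unif[where B = "B * 1"])
      show "\<bar>f (s * (1 - cos (2*x)) / 2) * cos (2 * real k * x)\<bar> \<le> B * 1" for x
        unfolding abs_mult using B[of 0] by (intro mult_mono B) auto
    qed measurable
    then show ?thesis by (simp add: distrib_right cos0 \<beta>_def)
  qed
  ultimately have M12: "((\<lambda>R. mode_coeff f k s R) \<longlongrightarrow> \<beta>) at_top" by simp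
  have "((\<lambda>R. mode_coeff f k R R) \<longlongrightarrow> (\<integral>x. (L + L) * cos (2 * real k * x) \<partial>unif)) at_top"
  proof (rule tendsto_mode_coeff[OF cont B])
    show "AE x in unif. ((\<lambda>R. spec_sum f R R x) \<longlongrightarrow> L + L) at_top"
      using AE_unif_cos_ne_1 by eventually_elim (rule tendsto_spec_sum_diag[OF lim])
  qed auto
  then have M22: "((\<lambda>R. mode_coeff f k R R) \<longlongrightarrow> 0) at_top" by (simp add: cos0)
  define m where "m = mode_coeff f k s s"
  \<comment> \<open>Turns the mixed term \<open>c * d * \<beta>\<close> into c times the absolute
    value of \<beta>.\<close>
  define d where "d = sgn \<beta>"
  \<comment> \<open>The cap 1 keeps the angular density nonnegative; the second bound ensures that
    \<open>c * m\<close> cannot cancel more than half of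
    \<open>2 * \<bar>\<beta>\<bar>\<close>.\<close>
  define c where "c = min 1 (\<bar>\<beta>\<bar> / (\<bar>m\<bar> + 1))"
  have \<beta>0: "\<beta> \<noteq> 0" using beta by (simp add: \<beta>_def)
  have c: "0 < c" "c \<le> 1" using \<beta>0 by (auto simp: c_def)
  have "c \<le> \<bar>\<beta>\<bar> / (\<bar>m\<bar> + 1)" by (simp add: c_def)
  then have "c * (\<bar>m\<bar> + 1) \<le> \<bar>\<beta>\<bar>"
    by (simp add: pos_le_divide_eq)
  moreover have "c * (- m) \<le> c * (\<bar>m\<bar> + 1)" using c by (intro mult_left_mono) auto
  moreover have "0 < \<bar>\<beta>\<bar>" using \<beta>0 by simp
  ultimately have "0 < c * m + 2 * \<bar>\<beta>\<bar>" by simp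
  then have "0 < c * (c * m + 2 * \<bar>\<beta>\<bar>)" using c by simp
  also have "\<dots> = c * c * m + 2 * (c * d * \<beta>) + d * d * 0"
    by (simp add: d_def algebra_simps mult_sgn_abs abs_sgn)
  finally have pos: "0 < c * c * m + 2 * (c * d * \<beta>) + d * d * 0" .
  have "((\<lambda>R. c * c * m + 2 * (c * d * mode_coeff f k s R) + d * d * mode_coeff f k R R) \<longlongrightarrow>
      c * c * m + 2 * (c * d * \<beta>) + d * d * 0) at_top"
    by (intro tendsto_intros M12 M22)
  then have "\<forall>\<^sub>F R in at_top. 0 < c * c * m + 2 * (c * d * mode_coeff f k s R) + d * d * mode_coeff f k R R"
    using pos by (rule order_tendstoD)
  then have "\<forall>\<^sub>F R in at_top. s < R \<and> 0 < c * c * m + 2 * (c * d * mode_coeff f k s R) + d * d * mode_coeff f k R R"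
    using eventually_gt_at_top[of s] by eventually_elim simp
  from eventually_happens[OF this] obtain R where "s < R" "0 < c * c * m + 2 * (c * d * mode_coeff f k s R) + d * d * mode_coeff f k R R"
    by auto
  moreover have "\<bar>c\<bar> \<le> 1" "\<bar>d\<bar> \<le> 1" using c by (auto simp: d_def sgn_if)
  ultimately show ?thesis using that unfolding m_def by blast
qed

section \<open>Laws carried by two circles\<close>

text \<open>The norm \<open>sqrt (2 * r)\<close> is the one at which \<open>radius\<close> equals
  r.\<close>

definition arc :: "nat \<Rightarrow> real \<Rightarrow> real \<Rightarrow> (real ^ 2) measure" where
  "arc k r c = distr (density unif (\<lambda>\<phi>. ennreal (1 + c * cos (2 * real k * \<phi>)))) borel
     (\<lambda>\<phi>. sqrt (2 * r) *\<^sub>R circ \<phi>)"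

definition shell_mean :: "real \<Rightarrow> (real ^ 2 \<Rightarrow> real) \<Rightarrow> real" where
  "shell_mean r g = (\<integral>\<phi>. g (sqrt (2 * r) *\<^sub>R circ \<phi>) \<partial>unif)"

definition shell_mode :: "nat \<Rightarrow> real \<Rightarrow> (real ^ 2 \<Rightarrow> real) \<Rightarrow> real" where
  "shell_mode k r g = (\<integral>\<phi>. cos (2 * real k * \<phi>) * g (sqrt (2 * r) *\<^sub>R circ \<phi>) \<partial>unif)"

lemma weight_nonneg:
  fixes c :: real
  assumes "\<bar>c\<bar> \<le> 1" shows "0 \<le> 1 + c * cos x"
proof -
  have "\<bar>c * cos x\<bar> \<le> 1 * 1" unfolding abs_mult using assms by (intro mult_mono) auto
  then show ?thesis by linarith
qed

lemma sets_arc [simp, measurable_cong]: "sets (arc k r c) = sets borel"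
  by (simp add: arc_def)

lemma shell_integrable:
  assumes [measurable]: "g \<in> borel_measurable borel"
    and B: "\<And>\<phi>. \<bar>g (sqrt (2 * r) *\<^sub>R circ \<phi>)\<bar> \<le> B"
  shows "integrable unif (\<lambda>\<phi>. g (sqrt (2 * r) *\<^sub>R circ \<phi>))"
    and "integrable unif (\<lambda>\<phi>. cos (2 * real k * \<phi>) * g (sqrt (2 * r) *\<^sub>R circ \<phi>))"
proof -
  show "integrable unif (\<lambda>\<phi>. g (sqrt (2 * r) *\<^sub>R circ \<phi>))"
    by (rule integrable_unif[OF _ B]) measurable
  show "integrable unif (\<lambda>\<phi>. cos (2 * real k * \<phi>) * g (sqrt (2 * r) *\<^sub>R circ \<phi>))"
  proof (rule integrable_unif[where B = "1 * B"])
    show "\<bar>cos (2 * real k * \<phi>) * g (sqrt (2 * r) *\<^sub>R circ \<phi>)\<bar> \<le> 1 * B" for \<phi>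
      unfolding abs_mult by (intro mult_mono B) auto
  qed measurable
qed

text \<open>Only values on the circle matter, so the bound is asked there alone; this admits
  coordinates and their products as test functions.\<close>

lemma arc_integral:
  assumes [measurable]: "g \<in> borel_measurable borel"
    and B: "\<And>\<phi>. \<bar>g (sqrt (2 * r) *\<^sub>R circ \<phi>)\<bar> \<le> B" and c: "\<bar>c\<bar> \<le> 1"
  shows "integrable (arc k r c) g"
    and "(\<integral>y. g y \<partial>arc k r c) = shell_mean r g + c * shell_mode k r g"
proof -
  note int = shell_integrable[of g r, OF assms(1) B]
  have eq: "(1 + c * cos (2 * real k * \<phi>)) * g (sqrt (2 * r) *\<^sub>R circ \<phi>) =
      g (sqrt (2 * r) *\<^sub>R circ \<phi>) + c * (cos (2 * real k * \<phi>) * g (sqrt (2 * r) *\<^sub>R circ \<phi>))" for \<phi>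
    by (simp add: algebra_simps)
  have ae: "AE \<phi> in unif. 0 \<le> 1 + c * cos (2 * real k * \<phi>)" by (simp add: weight_nonneg c)
  show "integrable (arc k r c) g"
    unfolding arc_def
    by (subst integrable_distr_eq, measurable, subst integrable_density[OF _ _ ae])
      (use int in \<open>auto simp: eq\<close>)
  show "(\<integral>y. g y \<partial>arc k r c) = shell_mean r g + c * shell_mode k r g"
    unfolding arc_def shell_mean_def shell_mode_def
    by (subst integral_distr, measurable, subst integral_density[OF _ _ ae])
      (use int in \<open>auto simp: eq\<close>)
qed

lemma shell_mode_const:
  assumes "0 < k" shows "shell_mode k r (\<lambda>_. a) = 0"
  using integral_unif_cos[of "2 * int k"] assms by (simp add: shell_mode_def)

text \<open>The density is nonnegative for amplitudes of size at most 1, and its cosine term has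
  mean 0.\<close>

lemma prob_space_arc:
  assumes k: "0 < k" and c: "\<bar>c\<bar> \<le> 1"
  shows "prob_space (arc k r c)"
  unfolding arc_def
proof (rule prob_space.prob_space_distr)
  have int: "integrable unif (\<lambda>\<phi>. 1 + c * cos (2 * real k * \<phi>))"
  proof (rule integrable_unif[where B = 2])
    show "\<bar>1 + c * cos (2 * real k * \<phi>)\<bar> \<le> 2" for \<phi>
      using weight_nonneg[OF c, of "2 * real k * \<phi>"] weight_nonneg[of "- c" "2 * real k * \<phi>"] c
      unfolding mult_minus_left abs_minus_cancel by linarith
  qed measurable
  show "prob_space (density unif (\<lambda>\<phi>. ennreal (1 + c * cos (2 * real k * \<phi>))))"
  proof
    have "emeasure (density unif (\<lambda>\<phi>. ennreal (1 + c * cos (2 * real k * \<phi>)))) UNIV =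
        (\<integral>\<^sup>+\<phi>. ennreal (1 + c * cos (2 * real k * \<phi>)) \<partial>unif)"
      by (subst emeasure_density) auto
    also have "\<dots> = ennreal (\<integral>\<phi>. 1 + c * cos (2 * real k * \<phi>) \<partial>unif)"
      by (rule nn_integral_eq_integral[OF int]) (simp add: weight_nonneg c)
    also have "(\<integral>\<phi>. 1 + c * cos (2 * real k * \<phi>) \<partial>unif) = 1"
    proof -
      have "integrable unif (\<lambda>_. 1 :: real)" by (rule integrable_unif[where B = 1]) auto
      then have "(\<integral>\<phi>. 1 + c * cos (2 * real k * \<phi>) \<partial>unif) = 1 + c * (\<integral>\<phi>. cos (2 * real k * \<phi>) \<partial>unif)"
        by (subst Bochner_Integration.integral_add) (simp_all only: integral_unif_const integral_mult_right_zero integrable_mult_right integrable_unif_trig)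
      then show ?thesis using integral_unif_cos[of "2 * int k"] k by simp
    qed
    finally show "emeasure (density unif (\<lambda>\<phi>. ennreal (1 + c * cos (2 * real k * \<phi>))))
       (space (density unif (\<lambda>\<phi>. ennreal (1 + c * cos (2 * real k * \<phi>))))) = 1" by simp
  qed
qed simp

lemma AE_arc: "AE y in arc k r c. 0 \<le> r \<longrightarrow> norm y = sqrt (2 * r)"
  unfolding arc_def by (subst AE_distr_iff) auto

lemma radius_measurable [measurable]: "radius \<in> borel_measurable borel"
  unfolding radius_def by measurable

lemma radius_circ [simp]: "0 \<le> r \<Longrightarrow> radius (sqrt (2 * r) *\<^sub>R circ \<phi>) = r"
  by (simp add: radius_def)

lemma shell_mean_orthogonal:
  assumes [measurable]: "g \<in> borel_measurable borel" and U: "orthogonal_matrix U"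
  shows "shell_mean r (\<lambda>y. g (U *v y)) = shell_mean r g"
proof -
  let ?h = "\<lambda>\<phi>. g (sqrt (2 * r) *\<^sub>R circ \<phi>)"
  have [measurable]: "?h \<in> borel_measurable borel" by measurable
  have per: "?h (\<phi> + 2*pi) = ?h \<phi>" for \<phi> by (simp add: circ_period)
  show ?thesis
  proof (rule orthogonal_2_cases[OF U])
    fix \<alpha> assume "U = rot \<alpha>"
    then show ?thesis
      using integral_unif_shift[of ?h \<alpha>, OF _ per]
      by (simp add: shell_mean_def rot_mult_circ matrix_vector_mult_scaleR)
  next
    fix \<alpha> assume "U = reflection \<alpha>"
    then show ?thesis
      using integral_unif_reflect[of ?h \<alpha>, OF _ per]
      by (simp add: shell_mean_def reflection_mult_circ matrix_vector_mult_scaleR)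
  qed
qed

text \<open>A Haar matrix sends each fixed point of a circle to a uniform point of that circle, so
  \<psi> disappears.\<close>

lemma haar2_integral:
  fixes g :: "real ^ 2 \<Rightarrow> real"
  assumes [measurable]: "g \<in> borel_measurable borel" and B: "\<And>y. \<bar>g y\<bar> \<le> B"
  shows "(\<integral>U. g (U *v (sqrt (2 * r) *\<^sub>R circ \<psi>)) \<partial>haar2) = shell_mean r g"
proof -
  let ?h = "\<lambda>\<phi>. g (sqrt (2 * r) *\<^sub>R circ \<phi>)"
  have [measurable]: "?h \<in> borel_measurable borel" by measurable
  have per: "?h (\<phi> + 2*pi) = ?h \<phi>" for \<phi> by (simp add: circ_period)
  let ?G = "\<lambda>U. g (U *v (sqrt (2 * r) *\<^sub>R circ \<psi>))"
  have [measurable]: "?G \<in> borel_measurable borel" by measurable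
  have i: "integrable (distr unif borel rot) ?G" "integrable (distr unif borel reflection) ?G"
    by (subst integrable_distr_eq; (intro integrable_unif[OF _ B])?; measurable)+
  have "(\<integral>U. ?G U \<partial>haar2) = 1/2 * (\<integral>U. ?G U \<partial>distr unif borel rot) + (1 - 1/2) * (\<integral>U. ?G U \<partial>distr unif borel reflection)"
    unfolding haar2_def by (rule integral_mix_law[OF _ i]) auto
  also have "(\<integral>U. ?G U \<partial>distr unif borel rot) = shell_mean r g"
    using integral_unif_shift[of ?h \<psi>, OF _ per]
    by (subst integral_distr) (simp_all add: shell_mean_def rot_mult_circ matrix_vector_mult_scaleR add.commute)
  \<comment> \<open>The random parameter \<phi> of the reflection sends angle \<psi> to
    \<open>\<phi> - \<psi>\<close>: as a function of \<phi> this is a shift.\<close>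
  also have "(\<integral>U. ?G U \<partial>distr unif borel reflection) = shell_mean r g"
    using integral_unif_shift[of ?h "- \<psi>", OF _ per]
    by (subst integral_distr) (simp_all add: shell_mean_def reflection_mult_circ matrix_vector_mult_scaleR)
  finally show ?thesis by simp
qed

section \<open>Equal mixtures of modulated circles: moments and symmetrization\<close>

locale two_shells =
  fixes k :: nat and s R :: real
  assumes k: "2 \<le> k" and s: "0 < s" and sR: "s < R"
begin

definition law :: "real \<Rightarrow> real \<Rightarrow> (real ^ 2) measure" where
  "law c d = mix_law (1/2) (arc k s c) (arc k R d)"

lemma R: "0 < R" using s sR by simp

lemma k0: "0 < k" using k by simp

lemma sets_law [simp, measurable_cong]: "sets (law c d) = sets borel"
  by (simp add: law_def)

lemma space_law [simp]: "space (law c d) = UNIV"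
  using sets_eq_imp_space_eq[OF sets_law] by simp

context
  fixes c d :: real
  assumes c: "\<bar>c\<bar> \<le> 1" and d: "\<bar>d\<bar> \<le> 1"
begin

lemma prob_space_law: "prob_space (law c d)"
  unfolding law_def by (intro prob_space_mix_law prob_space_arc k0 c d) auto

lemma law_in_laws: "law c d \<in> laws"
  by (simp add: laws_def prob_space_law)

lemma law_integral:
  assumes g: "g \<in> borel_measurable borel"
    and B: "\<And>\<phi>. \<bar>g (sqrt (2 * s) *\<^sub>R circ \<phi>)\<bar> \<le> B" "\<And>\<phi>. \<bar>g (sqrt (2 * R) *\<^sub>R circ \<phi>)\<bar> \<le> B"
  shows "integrable (law c d) g"
    and "(\<integral>y. g y \<partial>law c d) =
      (shell_mean s g + c * shell_mode k s g + shell_mean R g + d * shell_mode k R g) / 2"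
proof -
  note i = arc_integral(1)[of g s, OF g B(1) c] arc_integral(1)[of g R, OF g B(2) d]
  note e = arc_integral(2)[of g s, OF g B(1) c] arc_integral(2)[of g R, OF g B(2) d]
  show "integrable (law c d) g"
    unfolding law_def by (rule integrable_mix_law) (use i in auto)
  show "(\<integral>y. g y \<partial>law c d) =
      (shell_mean s g + c * shell_mode k s g + shell_mean R g + d * shell_mode k R g) / 2"
    unfolding law_def by (subst integral_mix_law[OF _ i]) (auto simp: e field_simps)
qed

lemma law_integral_indicator:
  assumes "A \<in> sets borel"
  shows "(\<integral>y. indicator A y \<partial>law c d) =
      (shell_mean s (indicator A) + c * shell_mode k s (indicator A) +
       shell_mean R (indicator A) + d * shell_mode k R (indicator A)) / 2"
  by (rule law_integral(2)[where B = 1]) (use assms in \<open>auto simp: indicator_def\<close>)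

text \<open>A radial function is constant on each circle, so the modulations integrate to 0. This is
  why the radial law is the same for all amplitudes.\<close>

lemma law_integral_radial:
  fixes a :: "real \<Rightarrow> real"
  assumes [measurable]: "a \<in> borel_measurable borel"
  shows "integrable (law c d) (\<lambda>y. a (radius y))" "(\<integral>y. a (radius y) \<partial>law c d) = (a s + a R) / 2"
proof -
  have m: "(\<lambda>y. a (radius y)) \<in> borel_measurable borel" by measurable
  note li = law_integral[of "\<lambda>y. a (radius y)" "max \<bar>a s\<bar> \<bar>a R\<bar>", OF m]
  show "integrable (law c d) (\<lambda>y. a (radius y))"
    by (rule li(1)) (use s R in auto)
  have "shell_mode k s (\<lambda>y. a (radius y)) = 0" "shell_mode k R (\<lambda>y. a (radius y)) = 0"
    using s R shell_mode_const[OF k0] by (simp_all add: shell_mode_def)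
  moreover have "shell_mean s (\<lambda>y. a (radius y)) = a s" "shell_mean R (\<lambda>y. a (radius y)) = a R"
    using s R by (simp_all add: shell_mean_def del: lebesgue_integral_const)
  ultimately show "(\<integral>y. a (radius y) \<partial>law c d) = (a s + a R) / 2"
    by (subst li(2)) (use s R in auto)
qed

lemma compactly_supported_law: "compactly_supported (law c d)"
  unfolding compactly_supported_def
proof (intro exI conjI)
  show "compact (cball 0 (sqrt (2 * R)) :: (real ^ 2) set)" by simp
  have [measurable]: "cball 0 (sqrt (2 * R)) \<in> sets (borel :: (real ^ 2) measure)" by simp
  show "AE y in law c d. y \<in> cball 0 (sqrt (2 * R))"
    unfolding law_def
  proof (rule AE_mix_lawI)
    show "AE y in arc k s c. y \<in> cball 0 (sqrt (2 * R))"
      using AE_arc[of s k c] by eventually_elim (use s sR in simp)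
    show "AE y in arc k R d. y \<in> cball 0 (sqrt (2 * R))"
      using AE_arc[of R k d] by eventually_elim (use R in simp)
  qed simp
qed

lemma radial_law_law: "radial_law (law c d) = mix_law (1/2) (return borel s) (return borel R)"
proof (rule prob_measure_eqI_integral[where K = borel])
  show "prob_space (radial_law (law c d))"
    unfolding radial_law_def by (intro prob_space.prob_space_distr[OF prob_space_law]) simp
  show "prob_space (mix_law (1/2) (return borel s) (return borel R))"
    by (intro prob_space_mix_law prob_space_return) auto
  fix A :: "real set" assume A [measurable]: "A \<in> sets borel"
  have i: "integrable (return borel a) (indicator A :: real \<Rightarrow> real)" for a :: real
    by (rule integrable_real_indicator) (auto simp: emeasure_return indicator_def)
  have "(\<integral>x. indicator A x \<partial>radial_law (law c d)) = (\<integral>y. (indicator A (radius y) :: real) \<partial>law c d)"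
    unfolding radial_law_def by (subst integral_distr) auto
  also have "\<dots> = (indicator A s + indicator A R) / 2" by (rule law_integral_radial(2)) simp
  also have "\<dots> = (\<integral>x. indicator A x \<partial>mix_law (1/2) (return borel s) (return borel R))"
    by (subst integral_mix_law[OF _ i i]) (simp_all add: measure_return field_simps)
  finally show "(\<integral>x. indicator A x \<partial>radial_law (law c d)) =
    (\<integral>x. (indicator A x :: real) \<partial>mix_law (1/2) (return borel s) (return borel R))" .
qed (auto simp: radial_law_def)

lemma two_point_radial_law: "two_point_law (radial_law (law c d))"
  unfolding two_point_law_def radial_law_law
  by (intro exI[of _ s] exI[of _ R] exI[of _ "1/2"]) (use sR in auto)

text \<open>Events of the conditioning sigma-algebra are preimages under \<open>radius\<close>.
  Their indicators are constant on each circle, so the conditional expectation can be tested circle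
  by circle, and there a vanishing mode k removes the dependence on the amplitudes.\<close>

lemma cond_exp_radius_law:
  assumes h [measurable]: "h \<in> borel_measurable borel" and a [measurable]: "a \<in> borel_measurable borel"
    and B: "\<And>\<phi>. \<bar>h (sqrt (2 * s) *\<^sub>R circ \<phi>)\<bar> \<le> B" "\<And>\<phi>. \<bar>h (sqrt (2 * R) *\<^sub>R circ \<phi>)\<bar> \<le> B"
    and sh: "\<And>r. r \<in> {s, R} \<Longrightarrow> shell_mean r h = a r" "\<And>r. r \<in> {s, R} \<Longrightarrow> shell_mode k r h = 0"
  shows "AE y in law c d. cond_exp_radius (law c d) h y = a (radius y)"
proof -
  let ?F = "vimage_algebra (space (law c d)) radius borel"
  have setsF: "sets ?F = {radius -` D |D. D \<in> sets borel}"
    by (subst sets_vimage_algebra2) auto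
  have sub: "subalgebra (law c d) ?F"
    unfolding subalgebra_def setsF
    using measurable_sets[OF radius_measurable] by (auto simp: space_vimage_algebra)
  interpret prob_space "law c d" by (rule prob_space_law)
  interpret finite_measure_subalgebra "law c d" ?F
    by (intro finite_measure_subalgebra.intro finite_measure_subalgebra_axioms.intro sub finite_measure_axioms)
  show ?thesis
    unfolding cond_exp_radius_def
  proof (rule real_cond_exp_charact)
    fix A assume "A \<in> sets ?F"
    then obtain D where A: "A = radius -` D" and D [measurable]: "D \<in> sets borel"
      unfolding setsF by blast
    let ?i = "\<lambda>r. indicator D r :: real"
    have B0: "0 \<le> B" using B(1)[of 0] by linarith
    have m: "(\<lambda>y. ?i (radius y) * h y) \<in> borel_measurable borel" by measurable
    have "(\<integral>y. ?i (radius y) * h y \<partial>law c d) = (?i s * a s + ?i R * a R) / 2"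
    proof (subst law_integral(2)[OF m, where B = B])
      show "\<bar>?i (radius (sqrt (2 * s) *\<^sub>R circ \<phi>)) * h (sqrt (2 * s) *\<^sub>R circ \<phi>)\<bar> \<le> B" for \<phi>
        using B(1)[of \<phi>] B0 by (auto simp: indicator_def)
      show "\<bar>?i (radius (sqrt (2 * R) *\<^sub>R circ \<phi>)) * h (sqrt (2 * R) *\<^sub>R circ \<phi>)\<bar> \<le> B" for \<phi>
        using B(2)[of \<phi>] B0 by (auto simp: indicator_def)
      have "shell_mean r (\<lambda>y. ?i (radius y) * h y) = ?i r * shell_mean r h"
        "shell_mode k r (\<lambda>y. ?i (radius y) * h y) = ?i r * shell_mode k r h" if "r \<in> {s, R}" for r
        using that s R by (auto simp: shell_mean_def shell_mode_def mult.left_commute[of _ "?i _"])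
      then show "(shell_mean s (\<lambda>y. ?i (radius y) * h y) + c * shell_mode k s (\<lambda>y. ?i (radius y) * h y) +
          shell_mean R (\<lambda>y. ?i (radius y) * h y) + d * shell_mode k R (\<lambda>y. ?i (radius y) * h y)) / 2 =
          (?i s * a s + ?i R * a R) / 2"
        by (simp add: sh)
    qed
    also have "\<dots> = (\<integral>y. ?i (radius y) * a (radius y) \<partial>law c d)"
      by (rule law_integral_radial(2)[of "\<lambda>r. ?i r * a r", symmetric]) measurable
    finally show "(\<integral>y\<in>A. h y \<partial>law c d) = (\<integral>y\<in>A. a (radius y) \<partial>law c d)"
      by (simp add: set_lebesgue_integral_def A indicator_vimage[unfolded comp_def] indicator_def)
  next
    show "integrable (law c d) h" by (rule law_integral(1)[OF h B])
    show "integrable (law c d) (\<lambda>y. a (radius y))" by (rule law_integral_radial(1)[OF a])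
    have "radius \<in> ?F \<rightarrow>\<^sub>M borel" by (rule measurable_vimage_algebra1) auto
    from measurable_compose[OF this a] show "(\<lambda>y. a (radius y)) \<in> borel_measurable ?F" .
  qed
qed

text \<open>Coordinates have frequency 1 and their products frequencies 0 and 2, while the
  modulation has frequency 2 k. For k = 1 it would change the second moments;
  \<open>k \<ge> 2\<close> keeps them.\<close>

lemma cond_isotropic_law: "cond_isotropic (law c d)"
  unfolding cond_isotropic_def
proof (intro conjI allI)
  have eq: "(\<lambda>y :: real ^ 2. (norm y)\<^sup>2) = (\<lambda>y. 2 * radius y)" by (simp add: radius_def)
  show "integrable (law c d) (\<lambda>y. (norm y)\<^sup>2)"
    unfolding eq by (rule law_integral_radial(1)[of "\<lambda>r. 2 * r"]) simp
next
  fix i :: 2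
  have e: "\<bar>(sqrt (2 * r) *\<^sub>R circ \<phi>) $ i\<bar> \<le> sqrt (2 * R)" if "r \<in> {s, R}" for r \<phi>
  proof -
    have "\<bar>(sqrt (2 * r) *\<^sub>R circ \<phi>) $ i\<bar> \<le> norm (sqrt (2 * r) *\<^sub>R circ \<phi>)" by (rule component_le_norm_cart)
    also have "\<dots> \<le> sqrt (2 * R)" using that s sR by auto
    finally show ?thesis .
  qed
  have "shell_mean r (\<lambda>y. y $ i) = 0" for r
    using exhaust_2[of i] integral_unif_cos[of 1] integral_unif_sin[of 1] by (auto simp: shell_mean_def)
  moreover have "shell_mode k r (\<lambda>y. y $ i) = 0" for r
  proof -
    have "(\<integral>\<phi>. cos (2 * real k * \<phi>) * circ \<phi> $ i \<partial>unif) = 0"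
      using exhaust_2[of i] k integral_unif_cos_cos[of "2 * int k" 1] integral_unif_sin_cos[of 1 "2 * int k"]
      by (auto simp: mult.commute)
    then show ?thesis by (simp add: shell_mode_def mult.left_commute[of _ "sqrt _"])
  qed
  ultimately show "AE y in law c d. cond_exp_radius (law c d) (\<lambda>z. z $ i) y = 0"
    using e by (intro cond_exp_radius_law[where a = "\<lambda>_. 0" and B = "sqrt (2 * R)"]) auto
next
  fix i j :: 2
  define \<delta> :: real where "\<delta> = (mat 1 :: real ^ 2 ^ 2) $ i $ j"
  have m: "(\<lambda>z :: real ^ 2. outer z $ i $ j) \<in> borel_measurable borel" by (simp add: outer_def)
  have e: "\<bar>outer (sqrt (2 * r) *\<^sub>R circ \<phi>) $ i $ j\<bar> \<le> 2 * R" if "r \<in> {s, R}" for r \<phi>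
  proof -
    have "\<bar>outer (sqrt (2 * r) *\<^sub>R circ \<phi>) $ i $ j\<bar> \<le> norm (sqrt (2 * r) *\<^sub>R circ \<phi>) * norm (sqrt (2 * r) *\<^sub>R circ \<phi>)"
      unfolding outer_def vec_lambda_beta abs_mult by (intro mult_mono component_le_norm_cart) auto
    also have "\<dots> \<le> 2 * R" using that s sR by auto
    finally show ?thesis .
  qed
  text \<open>Each entry is a constant plus a pure second harmonic.\<close>
  obtain \<beta> \<gamma> where out: "\<And>\<phi>. circ \<phi> $ i * circ \<phi> $ j = \<delta> / 2 + (\<beta> * cos (2*\<phi>) + \<gamma> * sin (2*\<phi>))"
  proof -
    consider "i = 1" "j = 1" | "i = 2" "j = 2" | "i = 1" "j = 2" | "i = 2" "j = 1"
      using exhaust_2[of i] exhaust_2[of j] by auto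
    then show ?thesis
    proof cases
      case 1
      then show ?thesis
        by (intro that[of "1/2" 0]) (simp add: \<delta>_def mat_def cos_double_cos, simp add: power2_eq_square field_simps)
    next
      case 2
      then show ?thesis
        by (intro that[of "-1/2" 0]) (simp add: \<delta>_def mat_def cos_double_sin, simp add: power2_eq_square field_simps)
    next
      case 3
      then show ?thesis
        by (intro that[of 0 "1/2"]) (auto simp: \<delta>_def mat_def sin_double)
    next
      case 4
      then show ?thesis
        by (intro that[of 0 "1/2"]) (auto simp: \<delta>_def mat_def sin_double)
    qed
  qed
  have sq: "outer (sqrt (2 * r) *\<^sub>R circ \<phi>) $ i $ j = 2 * r * (\<delta> / 2 + (\<beta> * cos (2*\<phi>) + \<gamma> * sin (2*\<phi>)))"
    if "0 \<le> r" for r \<phi>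
    unfolding out[symmetric] using that by (simp add: outer_def mult.left_commute[of _ "sqrt _"] flip: mult.assoc)
  have c2: "(\<integral>\<phi>. cos (2*\<phi>) \<partial>unif) = 0" "(\<integral>\<phi>. sin (2*\<phi>) \<partial>unif) = 0"
    using integral_unif_cos[of 2] integral_unif_sin[of 2] by auto
  have ck: "(\<integral>\<phi>. cos (2 * real k * \<phi>) \<partial>unif) = 0" "(\<integral>\<phi>. cos (2 * real k * \<phi>) * cos (2*\<phi>) \<partial>unif) = 0"
    "(\<integral>\<phi>. cos (2 * real k * \<phi>) * sin (2*\<phi>) \<partial>unif) = 0"
    using k integral_unif_cos[of "2 * int k"] integral_unif_cos_cos[of "2 * int k" 2]
      integral_unif_sin_cos[of 2 "2 * int k"] by (auto simp: mult.commute)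
  have ic: "integrable unif (\<lambda>\<phi>. cos (2 * real k * \<phi>) * cos (2*\<phi>))" "integrable unif (\<lambda>\<phi>. cos (2 * real k * \<phi>) * sin (2*\<phi>))"
    by (rule integrable_unif[where B = 1]; auto simp: abs_mult intro!: mult_le_one)+
  have ione: "integrable unif (\<lambda>_. x)" for x :: real
    by (rule integrable_unif[where B = "\<bar>x\<bar>"]) auto
  have "shell_mean r (\<lambda>z. outer z $ i $ j) = r * \<delta>" if "0 \<le> r" for r
    unfolding shell_mean_def sq[OF that]
    using c2 by (simp add: ione del: lebesgue_integral_const)
  moreover have "shell_mode k r (\<lambda>z. outer z $ i $ j) = 0" if "0 \<le> r" for r
  proof -
    have "cos (2 * real k * \<phi>) * (2 * r * (\<delta> / 2 + (\<beta> * cos (2*\<phi>) + \<gamma> * sin (2*\<phi>)))) =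
      r * \<delta> * cos (2 * real k * \<phi>) + (2 * r * \<beta> * (cos (2 * real k * \<phi>) * cos (2*\<phi>)) +
        2 * r * \<gamma> * (cos (2 * real k * \<phi>) * sin (2*\<phi>)))" for \<phi>
      by (simp add: algebra_simps)
    then show ?thesis
      unfolding shell_mode_def sq[OF that] using ic by (simp add: ck)
  qed
  ultimately have "AE y in law c d. cond_exp_radius (law c d) (\<lambda>z. outer z $ i $ j) y = radius y * \<delta>"
    using e s R by (intro cond_exp_radius_law[where a = "\<lambda>r. r * \<delta>" and B = "2 * R"] m) auto
  then show "AE y in law c d. cond_exp_radius (law c d) (\<lambda>z. outer z $ i $ j) y
      = (radius y *\<^sub>R (mat 1 :: real ^ 2 ^ 2)) $ i $ j"
    by (simp add: \<delta>_def)
qed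

end

text \<open>Integrate over the Haar matrix first. The result \<open>J\<close> is constant on each
  circle, so the modulations no longer contribute and the amplitudes may be replaced by 0.\<close>

lemma angular_symmetrization_law:
  assumes c: "\<bar>c\<bar> \<le> 1" and d: "\<bar>d\<bar> \<le> 1"
  shows "angular_symmetrization (law c d) = law 0 0"
proof -
  interpret h: prob_space haar2 by (rule prob_space_haar2)
  interpret l: prob_space "law c d" by (rule prob_space_law[OF c d])
  interpret p: pair_prob_space haar2 "law c d" ..
  have [measurable]: "(\<lambda>(U, y). U *v y) \<in> haar2 \<Otimes>\<^sub>M law c d \<rightarrow>\<^sub>M borel" by measurable
  have eq: "angular_symmetrization (law c d) = distr (haar2 \<Otimes>\<^sub>M law c d) borel (\<lambda>(U, y). U *v y)"
    by (simp add: angular_symmetrization_def haar_orthogonal_eq_haar2)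
  show ?thesis
    unfolding eq
  proof (rule prob_measure_eqI_integral[where K = borel])
    show "prob_space (distr (haar2 \<Otimes>\<^sub>M law c d) borel (\<lambda>(U, y). U *v y))"
      by (rule p.prob_space_distr) simp
    show "prob_space (law 0 0)"
      by (rule prob_space_law) auto
    fix A :: "(real ^ 2) set" assume A [measurable]: "A \<in> sets borel"
    let ?i = "indicator A :: real ^ 2 \<Rightarrow> real"
    define J where "J y = (\<integral>U. ?i (U *v y) \<partial>haar2)" for y
    have J: "J (sqrt (2 * r) *\<^sub>R circ \<psi>) = shell_mean r ?i" for r \<psi>
      unfolding J_def by (rule haar2_integral[where B = 1]) (auto simp: indicator_def)
    have Jm: "J \<in> borel_measurable borel"
    proof -
      have "J \<in> borel_measurable (law c d)"
        unfolding J_def by (rule h.borel_measurable_lebesgue_integral) measurable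
      then show ?thesis by simp
    qed
    have int: "integrable (haar2 \<Otimes>\<^sub>M law c d) (\<lambda>(U, y). ?i (U *v y))"
      by (rule p.P.integrable_const_bound[where B = 1]) (auto simp: indicator_def)
    have "(\<integral>x. ?i x \<partial>distr (haar2 \<Otimes>\<^sub>M law c d) borel (\<lambda>(U, y). U *v y)) =
        (\<integral>(U, y). ?i (U *v y) \<partial>(haar2 \<Otimes>\<^sub>M law c d))"
      by (subst integral_distr) (auto simp: case_prod_unfold)
    also have "\<dots> = (\<integral>y. J y \<partial>law c d)"
      unfolding J_def by (rule p.integral_snd[OF int, symmetric])
    also have "\<dots> = (shell_mean s J + c * shell_mode k s J + shell_mean R J + d * shell_mode k R J) / 2"
      by (rule law_integral(2)[OF c d Jm, where B = "max \<bar>shell_mean s ?i\<bar> \<bar>shell_mean R ?i\<bar>"]) (auto simp: J)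
    also have "\<dots> = (shell_mean s ?i + shell_mean R ?i) / 2"
    proof -
      have "shell_mode k r J = shell_mode k r (\<lambda>_. shell_mean r ?i)" for r
        by (simp only: shell_mode_def J)
      moreover have "shell_mean r J = shell_mean r ?i" for r
        by (simp only: shell_mean_def[of r J] J integral_unif_const)
      ultimately show ?thesis by (simp only: shell_mode_const[OF k0]) simp
    qed
    finally have "(\<integral>x. ?i x \<partial>distr (haar2 \<Otimes>\<^sub>M law c d) borel (\<lambda>(U, y). U *v y)) =
      (shell_mean s ?i + shell_mean R ?i) / 2" .
    then show "(\<integral>x. ?i x \<partial>distr (haar2 \<Otimes>\<^sub>M law c d) borel (\<lambda>(U, y). U *v y)) = (\<integral>x. ?i x \<partial>law 0 0)"
      using law_integral_indicator[of 0 0 A] A by simp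
  qed auto
qed

text \<open>Integrals are affine in the amplitudes, so opposite modulations cancel.\<close>

lemma mix_law_opposite:
  assumes c: "\<bar>c\<bar> \<le> 1" and d: "\<bar>d\<bar> \<le> 1"
  shows "mix_law (1/2) (law c d) (law (- c) (- d)) = law 0 0"
proof (rule prob_measure_eqI_integral[where K = borel])
  show "prob_space (mix_law (1/2) (law c d) (law (- c) (- d)))"
    by (intro prob_space_mix_law prob_space_law) (use c d in auto)
  show "prob_space (law 0 0)" by (rule prob_space_law) auto
  fix A :: "(real ^ 2) set" assume A: "A \<in> sets borel"
  have i: "integrable (law a b) (indicator A :: real ^ 2 \<Rightarrow> real)" if "\<bar>a\<bar> \<le> 1" "\<bar>b\<bar> \<le> 1" for a b
    by (rule law_integral(1)[OF that, where B = 1]) (use A in \<open>auto simp: indicator_def\<close>)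
  have "(\<integral>y. indicator A y \<partial>mix_law (1/2) (law c d) (law (- c) (- d))) =
      1/2 * (\<integral>y. indicator A y \<partial>law c d) + (1 - 1/2) * (\<integral>y. (indicator A y :: real) \<partial>law (- c) (- d))"
    by (rule integral_mix_law) (use c d i in auto)
  also have "\<dots> = (\<integral>y. indicator A y \<partial>law 0 0)"
  proof -
    have m: "\<bar>- c\<bar> \<le> 1" "\<bar>- d\<bar> \<le> 1" "\<bar>0 :: real\<bar> \<le> 1" using c d by auto
    show ?thesis
      unfolding law_integral_indicator[OF c d A] law_integral_indicator[OF m(1,2) A]
        law_integral_indicator[OF m(3,3) A]
      by (simp add: field_simps)
  qed
  finally show "(\<integral>y. indicator A y \<partial>mix_law (1/2) (law c d) (law (- c) (- d))) =
      (\<integral>y. (indicator A y :: real) \<partial>law 0 0)" .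
qed auto

lemma spherical_law: "spherical (law 0 0)"
  unfolding spherical_def
proof (intro allI impI)
  fix U :: "real ^ 2 ^ 2" assume U: "orthogonal_matrix U"
  show "distr (law 0 0) borel ((*v) U) = law 0 0"
  proof (rule prob_measure_eqI_integral[where K = borel])
    show "prob_space (law 0 0)" by (rule prob_space_law) auto
    show "prob_space (distr (law 0 0) borel ((*v) U))"
      by (intro prob_space.prob_space_distr prob_space_law) auto
    fix A :: "(real ^ 2) set" assume A [measurable]: "A \<in> sets borel"
    let ?i = "indicator A :: real ^ 2 \<Rightarrow> real"
    have m: "(\<lambda>y. ?i (U *v y)) \<in> borel_measurable borel" by measurable
    have "(\<integral>y. ?i y \<partial>distr (law 0 0) borel ((*v) U)) = (\<integral>y. ?i (U *v y) \<partial>law 0 0)"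
      by (subst integral_distr) auto
    also have "\<dots> = (shell_mean s ?i + shell_mean R ?i) / 2"
    proof -
      have "(\<integral>y. ?i (U *v y) \<partial>law 0 0) =
          (shell_mean s (\<lambda>y. ?i (U *v y)) + 0 * shell_mode k s (\<lambda>y. ?i (U *v y)) +
           shell_mean R (\<lambda>y. ?i (U *v y)) + 0 * shell_mode k R (\<lambda>y. ?i (U *v y))) / 2"
        by (rule law_integral(2)[OF _ _ m, where B = 1]) (auto split: split_indicator)
      then show ?thesis by (simp add: shell_mean_orthogonal[OF _ U])
    qed
    also have "\<dots> = (\<integral>y. ?i y \<partial>law 0 0)"
      using law_integral_indicator[of 0 0 A] A by simp
    finally show "(\<integral>y. ?i y \<partial>distr (law 0 0) borel ((*v) U)) = (\<integral>y. ?i y \<partial>law 0 0)" .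
  qed auto
qed

end

section \<open>The quadratic expansion of the functional\<close>

text \<open>Here \<open>m\<^sup>2 - v\<^sup>2\<close> is the determinant of \<open>H\<close>, a
  quarter of the squared determinant of the two columns. So both eigenvalues are nonnegative and the
  truncation at 0 changes nothing.\<close>

lemma trace_matrix_fun_outer:
  fixes y1 y2 :: "real ^ 2"
  defines "H \<equiv> (1/2) *\<^sub>R (outer y1 + outer y2)"
  defines "m \<equiv> (H $ 1 $ 1 + H $ 2 $ 2) / 2"
    and "v \<equiv> sqrt (((H $ 1 $ 1 - H $ 2 $ 2) / 2)\<^sup>2 + (H $ 1 $ 2)\<^sup>2)"
  shows "trace (matrix_fun f H) = f (max 0 (m + v)) + f (max 0 (m - v))"
proof -
  have H: "H $ i $ j = (y1 $ i * y1 $ j + y2 $ i * y2 $ j) / 2" for i j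
    by (simp add: H_def outer_def field_simps)
  have sym: "H $ 1 $ 2 = H $ 2 $ 1" by (simp add: H mult.commute)
  have m0: "0 \<le> m" by (simp add: m_def H add_nonneg_nonneg)
  have "((H $ 1 $ 1 - H $ 2 $ 2) / 2)\<^sup>2 + (H $ 1 $ 2)\<^sup>2 = m\<^sup>2 - ((y1 $ 1 * y2 $ 2 - y1 $ 2 * y2 $ 1) / 2)\<^sup>2"
    unfolding m_def H by (simp add: power2_eq_square field_simps)
  then have "v \<le> m" unfolding v_def using m0 by (intro real_le_lsqrt) auto
  moreover have "0 \<le> v" by (simp add: v_def)
  ultimately show ?thesis
    using trace_matrix_fun_2[OF sym, of f] m0 by (simp add: m_def v_def)
qed

text \<open>Lets f, controlled only on the half-line, be replaced by a function continuous on the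
  whole line.\<close>

lemma F_fun_extend: "F_fun f = F_fun (\<lambda>x. f (max 0 x))"
  unfolding F_fun_def trace_matrix_fun_outer by (simp add: fun_eq_iff)

definition spec_trace :: "(real \<Rightarrow> real) \<Rightarrow> real ^ 2 \<Rightarrow> real ^ 2 \<Rightarrow> real" where
  "spec_trace f y1 y2 = trace (matrix_fun f ((1/2) *\<^sub>R (outer y1 + outer y2)))"

lemma spec_trace_bounded:
  assumes "\<And>x. \<bar>f x\<bar> \<le> B" shows "\<bar>spec_trace f y1 y2\<bar> \<le> 2 * B"
  unfolding spec_trace_def trace_matrix_fun_outer mult_2
  by (rule order_trans[OF abs_triangle_ineq]) (intro add_mono assms)

text \<open>Measurability is read off the explicit eigenvalue formula, since
  \<open>matrix_fun\<close> itself is a definite description.\<close>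

lemma measurable_spec_trace [measurable]:
  assumes f: "continuous_on UNIV f" and [measurable]: "g \<in> borel_measurable M" "h \<in> borel_measurable M"
  shows "(\<lambda>x. spec_trace f (g x) (h x)) \<in> borel_measurable M"
proof -
  have [measurable]: "f \<in> borel_measurable borel" using f by (rule borel_measurable_continuous_onI)
  have [measurable]: "(\<lambda>x. g x $ i) \<in> borel_measurable M" "(\<lambda>x. h x $ i) \<in> borel_measurable M" for i
    by (rule borel_measurable_continuous_on[OF _ assms(2)] borel_measurable_continuous_on[OF _ assms(3)];
        intro continuous_intros)+
  show ?thesis unfolding spec_trace_def trace_matrix_fun_outer
    by (simp add: outer_def) measurable
qed

lemma spec_trace_circ:
  assumes "0 \<le> r" "0 \<le> s"
  shows "spec_trace f (sqrt (2 * r) *\<^sub>R circ \<phi>) (sqrt (2 * s) *\<^sub>R circ \<psi>) = spec_sum f r s (\<psi> - \<phi>)"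
  unfolding spec_trace_def spec_sum_def by (rule trace_matrix_fun_circ[OF assms])

lemma spec_sum_period: "spec_sum f r s (\<phi> + 2*pi) = spec_sum f r s \<phi>"
  using cos_period_int[of 2 \<phi>] by (simp add: spec_sum_def)

lemma spec_sum_even: "spec_sum f r s (- \<phi>) = spec_sum f r s \<phi>"
  by (simp add: spec_sum_def)

lemma spec_sum_commute: "spec_sum f r s = spec_sum f s r"
  by (simp add: spec_sum_def fun_eq_iff add.commute mult.commute mult.left_commute)

lemma mode_coeff_commute: "mode_coeff f k r s = mode_coeff f k s r"
  unfolding mode_coeff_def by (subst spec_sum_commute) (rule refl)

context
  fixes f :: "real \<Rightarrow> real" and B :: real
  assumes cont: "continuous_on UNIV f" and bound: "\<And>x. \<bar>f x\<bar> \<le> B"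
begin

lemma measurable_spec_sum [measurable]: "spec_sum f r s \<in> borel_measurable borel"
  by (rule borel_measurable_continuous_onI[OF continuous_on_spec_sum[OF cont]])

lemma spec_sum_bounded: "\<bar>spec_sum f r s \<phi>\<bar> \<le> 2 * B"
  unfolding spec_sum_def mult_2 by (rule order_trans[OF abs_triangle_ineq]) (intro add_mono bound)

lemma shell_mean_spec_trace:
  assumes "0 \<le> r" "0 \<le> s"
  shows "shell_mean s (spec_trace f (sqrt (2 * r) *\<^sub>R circ \<phi>)) = (\<integral>x. spec_sum f r s x \<partial>unif)"
  unfolding shell_mean_def spec_trace_circ[OF assms]
  using integral_unif_shift[of "spec_sum f r s" "- \<phi>"] by (simp add: spec_sum_period)

text \<open>Convolution with an even kernel acts on cosines as a scalar: shift the angle by \<phi>,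
  expand the cosine of the sum, and the sine part integrates to 0 by parity.\<close>

lemma shell_mode_spec_trace:
  assumes "0 \<le> r" "0 \<le> s"
  shows "shell_mode k s (spec_trace f (sqrt (2 * r) *\<^sub>R circ \<phi>)) = cos (2 * real k * \<phi>) * mode_coeff f k r s"
proof -
  have cp: "cos (2 * real k * (x + 2*pi)) = cos (2 * real k * x)"
    and sp: "sin (2 * real k * (x + 2*pi)) = sin (2 * real k * x)" for x
    using cos_period_int[of "2 * int k" x] sin_period_int[of "2 * int k" x] by simp_all
  have B0: "0 \<le> B" using bound[of 0] by linarith
  let ?g = "\<lambda>x. cos (2 * real k * (x + \<phi>)) * spec_sum f r s x"
  have ic: "integrable unif (\<lambda>x. spec_sum f r s x * cos (2 * real k * x))"
    by (rule integrable_unif[where B = "2 * B * 1"])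
      (measurable, unfold abs_mult, intro mult_mono spec_sum_bounded, use B0 in auto)
  have sn: "integrable unif (\<lambda>x. spec_sum f r s x * sin (2 * real k * x))"
    by (rule integrable_unif[where B = "2 * B * 1"])
      (measurable, unfold abs_mult, intro mult_mono spec_sum_bounded, use B0 in auto)
  have odd: "(\<integral>x. spec_sum f r s x * sin (2 * real k * x) \<partial>unif) = 0"
    using integral_unif_reflect[of "\<lambda>x. spec_sum f r s x * sin (2 * real k * x)" 0]
    by (simp add: spec_sum_period spec_sum_even sp)
  have "?g (x + 2*pi) = ?g x" for x
    using cp[of "x + \<phi>"] by (simp add: spec_sum_period add.assoc add.commute add.left_commute)
  then have "(\<integral>x. ?g (x + - \<phi>) \<partial>unif) = (\<integral>x. ?g x \<partial>unif)"
    by (intro integral_unif_shift) measurable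
  then have "shell_mode k s (spec_trace f (sqrt (2 * r) *\<^sub>R circ \<phi>)) = (\<integral>x. ?g x \<partial>unif)"
    unfolding shell_mode_def spec_trace_circ[OF assms] by simp
  also have "?g = (\<lambda>x. cos (2 * real k * \<phi>) * (spec_sum f r s x * cos (2 * real k * x)) -
      sin (2 * real k * \<phi>) * (spec_sum f r s x * sin (2 * real k * x)))"
    by (simp add: fun_eq_iff distrib_left cos_add algebra_simps)
  also have "(\<integral>x. cos (2 * real k * \<phi>) * (spec_sum f r s x * cos (2 * real k * x)) -
      sin (2 * real k * \<phi>) * (spec_sum f r s x * sin (2 * real k * x)) \<partial>unif) =
      cos (2 * real k * \<phi>) * mode_coeff f k r s"
    using ic sn by (simp add: odd mode_coeff_def)
  finally show ?thesis .
qed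

end

text \<open>The factor 1/16 collects the prefactor 1/2 of \<open>F_fun\<close>, the weights 1/2 of
  the two mixtures, and the mean 1/2 of the squared cosine.\<close>

lemma (in two_shells) F_fun_law:
  assumes cont: "continuous_on UNIV f" and bound: "\<And>x. \<bar>f x\<bar> \<le> B"
    and c: "\<bar>c\<bar> \<le> 1" and d: "\<bar>d\<bar> \<le> 1"
  shows "F_fun f (law c d) = F_fun f (law 0 0) +
    (c * c * mode_coeff f k s s + 2 * (c * d * mode_coeff f k s R) + d * d * mode_coeff f k R R) / 16"
proof -
  define Z where "Z r t = (\<integral>x. spec_sum f r t x \<partial>unif)" for r t
  have gen: "F_fun f (law c d) = (Z s s + Z s R + Z R s + Z R R) / 8 +
    (c * c * mode_coeff f k s s + 2 * (c * d * mode_coeff f k s R) + d * d * mode_coeff f k R R) / 16"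
    if c: "\<bar>c\<bar> \<le> 1" and d: "\<bar>d\<bar> \<le> 1" for c d
  proof -
    interpret l: prob_space "law c d" by (rule prob_space_law[OF c d])
    interpret p: pair_prob_space "law c d" "law c d" ..
    note [measurable] = measurable_spec_trace[OF cont]
    have int: "integrable (law c d \<Otimes>\<^sub>M law c d) (\<lambda>(y1, y2). spec_trace f y1 y2)"
      by (rule p.P.integrable_const_bound[where B = "2 * B"])
        (auto simp: spec_trace_bounded[OF bound] split_beta')
    define J where "J y = (\<integral>z. spec_trace f y z \<partial>law c d)" for y
    have Jm: "J \<in> borel_measurable borel"
    proof -
      have "J \<in> borel_measurable (law c d)"
        unfolding J_def by (rule l.borel_measurable_lebesgue_integral) (auto simp: split_beta')
      then show ?thesis by simp
    qed
    \<comment> \<open>Integrating out one column leaves on each circle a constant plus a multiple of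
      the same mode; the second integration pairs it with its own modulation.\<close>
    have J: "J (sqrt (2 * r) *\<^sub>R circ \<phi>) = (Z r s + Z r R) / 2 +
        cos (2 * real k * \<phi>) * ((c * mode_coeff f k r s + d * mode_coeff f k r R) / 2)"
      if r: "0 \<le> r" for r \<phi>
    proof -
      have m: "spec_trace f (sqrt (2 * r) *\<^sub>R circ \<phi>) \<in> borel_measurable borel" by measurable
      have e: "shell_mean s (spec_trace f (sqrt (2 * r) *\<^sub>R circ \<phi>)) = Z r s"
        "shell_mean R (spec_trace f (sqrt (2 * r) *\<^sub>R circ \<phi>)) = Z r R"
        "shell_mode k s (spec_trace f (sqrt (2 * r) *\<^sub>R circ \<phi>)) = cos (2 * real k * \<phi>) * mode_coeff f k r s"
        "shell_mode k R (spec_trace f (sqrt (2 * r) *\<^sub>R circ \<phi>)) = cos (2 * real k * \<phi>) * mode_coeff f k r R"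
        using s R by (simp_all only: Z_def shell_mean_spec_trace[OF cont bound r less_imp_le]
            shell_mode_spec_trace[OF cont bound r less_imp_le])
      show ?thesis
        unfolding J_def law_integral(2)[OF c d m spec_trace_bounded[OF bound] spec_trace_bounded[OF bound]] e
        by (simp add: field_simps)
    qed
    have one: "integrable unif (\<lambda>_. x)" for x :: real
      by (rule integrable_unif[where B = "\<bar>x\<bar>"]) auto
    have cc: "integrable unif (\<lambda>\<phi>. cos (2 * real k * \<phi>) * cos (2 * real k * \<phi>))"
    proof (rule integrable_unif[where B = 1])
      show "\<bar>cos (2 * real k * \<phi>) * cos (2 * real k * \<phi>)\<bar> \<le> 1" for \<phi>
        unfolding abs_mult by (rule mult_le_one) auto
    qed measurable
    have c0: "(\<integral>\<phi>. cos (2 * real k * \<phi>) \<partial>unif) = 0"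
      and c1: "(\<integral>\<phi>. cos (2 * real k * \<phi>) * cos (2 * real k * \<phi>) \<partial>unif) = 1/2"
      using k0 integral_unif_cos[of "2 * int k"] integral_unif_cos_cos[of "2 * int k" "2 * int k"] by simp_all
    have mean: "shell_mean r J = (Z r s + Z r R) / 2" if r: "0 \<le> r" for r
      unfolding shell_mean_def J[OF r] using one by (simp add: c0 del: lebesgue_integral_const)
    have mode: "shell_mode k r J = (c * mode_coeff f k r s + d * mode_coeff f k r R) / 4" if r: "0 \<le> r" for r
      unfolding shell_mode_def J[OF r] distrib_left mult.assoc[symmetric] using cc by (simp add: c0 c1)
    have bJ: "\<bar>J y\<bar> \<le> 2 * B" for y
    proof -
      have "norm (J y) \<le> (\<integral>z. 2 * B \<partial>law c d)"
        unfolding J_def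
        by (rule Bochner_Integration.integral_norm_bound_integral)
          (auto simp: spec_trace_bounded[OF bound] intro!: l.integrable_const_bound[where B = "2 * B"])
      then show ?thesis using l.prob_space by simp
    qed
    have "F_fun f (law c d) = 1/2 * (\<integral>(y1, y2). spec_trace f y1 y2 \<partial>(law c d \<Otimes>\<^sub>M law c d))"
      by (simp add: F_fun_def spec_trace_def)
    also have "(\<integral>(y1, y2). spec_trace f y1 y2 \<partial>(law c d \<Otimes>\<^sub>M law c d)) = (\<integral>y. J y \<partial>law c d)"
      unfolding J_def by (rule p.integral_fst'[OF int, symmetric, unfolded prod.case])
    also have "\<dots> = (shell_mean s J + c * shell_mode k s J + shell_mean R J + d * shell_mode k R J) / 2"
      by (rule law_integral(2)[OF c d Jm bJ bJ])
    finally show ?thesis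
      using s R by (simp add: mean mode mode_coeff_commute[of f k R s] field_simps)
  qed
  show ?thesis using gen[OF c d] gen[of 0 0] by simp
qed

theorem propositionC1:
  fixes f :: "real \<Rightarrow> real"
  assumes "continuous_on {0..} f"
    and "\<not> f constant_on {0..}"
    and "\<exists>L. (f \<longlongrightarrow> L) at_top"
  shows "\<exists>\<sigma>\<^sub>p \<in> laws. \<exists>\<sigma>\<^sub>m \<in> laws. \<exists>\<sigma>\<^sub>0.
     compactly_supported \<sigma>\<^sub>p \<and> compactly_supported \<sigma>\<^sub>m \<and>
     radial_law \<sigma>\<^sub>p = radial_law \<sigma>\<^sub>m \<and> two_point_law (radial_law \<sigma>\<^sub>p) \<and>
     cond_isotropic \<sigma>\<^sub>p \<and> cond_isotropic \<sigma>\<^sub>m \<and>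
     \<sigma>\<^sub>0 = mix_law (1 / 2) \<sigma>\<^sub>p \<sigma>\<^sub>m \<and> spherical \<sigma>\<^sub>0 \<and>
     F_fun f \<sigma>\<^sub>p = F_fun f \<sigma>\<^sub>m \<and> F_fun f \<sigma>\<^sub>m > F_fun f \<sigma>\<^sub>0 \<and>
     angular_symmetrization \<sigma>\<^sub>p = \<sigma>\<^sub>0 \<and> angular_symmetrization \<sigma>\<^sub>m = \<sigma>\<^sub>0 \<and>
     \<not> concave_on_laws (isotropic_laws (radial_law \<sigma>\<^sub>p)) (F_fun f) \<and>
     \<not> (\<forall>\<sigma> \<in> isotropic_laws (radial_law \<sigma>\<^sub>p). F_fun f \<sigma> \<le> F_fun f (angular_symmetrization \<sigma>))"
proof -
  \<comment> \<open>Values of \<open>f\<close> at negative arguments are unconstrained, so they are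
    overwritten by \<open>f 0\<close>.\<close>
  define g where "g x = f (max 0 x)" for x
  obtain L where L: "(f \<longlongrightarrow> L) at_top" using assms(3) by blast
  have cont: "continuous_on UNIV g"
    unfolding g_def by (rule continuous_on_compose2[OF assms(1)]) (auto intro!: continuous_intros)
  have nc: "\<not> g constant_on {0..}"
    using assms(2) by (auto simp: constant_on_def g_def max_def)
  have "\<forall>\<^sub>F x in at_top. f x = g x"
    using eventually_ge_at_top[of 0] by eventually_elim (simp add: g_def max_def)
  with L have lim: "(g \<longlongrightarrow> L) at_top" by (rule Lim_transform_eventually)
  have neg: "g x = g 0" if "x \<le> 0" for x using that by (simp add: g_def)
  obtain B where B: "\<And>x. \<bar>g x\<bar> \<le> B"
    using bounded_if_limits[OF cont lim neg] by blast
  obtain s k where s: "0 < s" and k: "2 \<le> k"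
    and beta: "(\<integral>x. g (s * (1 - cos (2*x)) / 2) * cos (2 * real k * x) \<partial>unif) \<noteq> 0"
    using ex_high_mode[OF cont lim nc] by blast
  have k0: "0 < k" using k by simp
  obtain R c d where sR: "s < R" and c: "\<bar>c\<bar> \<le> 1" and d: "\<bar>d\<bar> \<le> 1"
    and pos: "c * c * mode_coeff g k s s + 2 * (c * d * mode_coeff g k s R) + d * d * mode_coeff g k R R > 0"
    using ex_positive_direction[OF cont B lim s k0 beta] by blast
  interpret two_shells k s R by standard (use k s sR in auto)
  have c': "\<bar>- c\<bar> \<le> 1" and d': "\<bar>- d\<bar> \<le> 1" using c d by auto
  \<comment> \<open>Reversing both amplitudes fixes the quadratic form and centers the average at
    \<open>law 0 0\<close>.\<close>
  let ?p = "law c d" and ?m = "law (- c) (- d)"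
  have F: "F_fun f = F_fun g" unfolding g_def by (rule F_fun_extend)
  have mix: "mix_law (1/2) ?p ?m = law 0 0" by (rule mix_law_opposite[OF c d])
  have Fpm: "F_fun f ?p = F_fun f ?m"
    unfolding F using F_fun_law[OF cont B c d] F_fun_law[OF cont B c' d'] by simp
  have gt: "F_fun f ?m > F_fun f (law 0 0)"
    unfolding Fpm[symmetric] unfolding F using F_fun_law[OF cont B c d] pos by simp
  have rad: "radial_law ?p = radial_law ?m"
    by (simp add: radial_law_law[OF c d] radial_law_law[OF c' d'])
  have iso: "?p \<in> isotropic_laws (radial_law ?p)" "?m \<in> isotropic_laws (radial_law ?p)"
    using rad by (simp_all add: isotropic_laws_def law_in_laws c d c' d' cond_isotropic_law)
  have nconc: "\<not> concave_on_laws (isotropic_laws (radial_law ?p)) (F_fun f)"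
  proof
    assume "concave_on_laws (isotropic_laws (radial_law ?p)) (F_fun f)"
    then have "t * F_fun f ?p + (1 - t) * F_fun f ?m \<le> F_fun f (mix_law t ?p ?m)" if "0 \<le> t" "t \<le> 1" for t
      using iso that unfolding concave_on_laws_def by blast
    \<comment> \<open>At the midpoint, concavity would bound the common value of the two laws by the
      strictly smaller value at their average.\<close>
    from this[of "1/2"] show False using Fpm gt mix by simp
  qed
  \<comment> \<open>The law \<open>?m\<close> already violates the claim, as its symmetrization is
    \<open>law 0 0\<close>.\<close>
  have nmax: "\<not> (\<forall>\<sigma> \<in> isotropic_laws (radial_law ?p). F_fun f \<sigma> \<le> F_fun f (angular_symmetrization \<sigma>))"
    using iso gt angular_symmetrization_law[OF c' d'] by force
  show ?thesis
    by (intro bexI[of _ ?p] bexI[of _ ?m] exI[of _ "law 0 0"] conjI)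
      (use Fpm gt rad nconc nmax mix in \<open>simp_all add: law_in_laws c d c' d' compactly_supported_law
        two_point_radial_law cond_isotropic_law spherical_law angular_symmetrization_law
        del: abs_minus_cancel\<close>)
qed

end
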